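(* Let $\alpha\in\mathbb{R}$ and let $a/q$ be a reduced fraction with $|\alpha - a/q|\leqslant 1/q^2$. Then for $X\geqslant 2$, \[ \sum_{n\leqslant X}\hat{\mu}(n)\operatorname{e}(n\alpha) \ll \left( X^{5/6} + q^{1/2}X^{1/2} + \frac{X}{q^{1/2}}\right)(\log X)^{5/2}. \]
   Context: $\hat{\mu} = \mu * f$ is the Dirichlet convolution of the Möbius function $\mu$ with the indicator function $f$ of the squarefull positive integers (integers $n$ such that $p\mid n$ implies $p^2\mid n$ for every prime $p$). $\operatorname{e}(x) = \exp(2\pi i x)$. *)

theory Defs
  imports Complex_Main "HOL-Computational_Algebra.Squarefree"
begin

definition mobius_mu :: "nat \<Rightarrow> int" where
  "mobius_mu n = (if squarefree n then (-1) ^ card (prime_factors n) else 0)"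

(* Only meaningful at n > 0: the sum over all divisors of 0 is infinite, hence 0. *)
definition dirichlet_conv :: "(nat \<Rightarrow> int) \<Rightarrow> (nat \<Rightarrow> int) \<Rightarrow> nat \<Rightarrow> int" where
  "dirichlet_conv g h n = (\<Sum>d | d dvd n. g d * h (n div d))"

definition squarefull :: "nat \<Rightarrow> bool" where
  "squarefull n \<longleftrightarrow> n > 0 \<and> (\<forall>p. prime p \<longrightarrow> p dvd n \<longrightarrow> p ^ 2 dvd n)"

definition mu_hat :: "nat \<Rightarrow> int" where
  "mu_hat = dirichlet_conv mobius_mu (\<lambda>n. of_bool (squarefull n))"

definition e :: "real \<Rightarrow> complex" where
  "e x = exp (2 * of_real pi * \<i> * of_real x)"

end

theory Submission
  imports Defs "HOL-Analysis.Harmonic_Numbers" "HOL-Analysis.Convex" "HOL-Analysis.Complex_Transcendental"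
begin

text \<open>
  Since \<open>1 * mu_hat\<close> is the indicator function of the squarefull numbers, Vaughan's identity with both
  cut-offs at \<open>X\<^sup>1\<^sup>/\<^sup>3\<close> applies to \<open>mu_hat\<close>; the squarefull numbers are so sparse that the term containing
  them is bounded trivially. In the type I sum the divisor-function weight is removed by the
  Cauchy--Schwarz inequality, which costs \<open>(log X)\<^sup>5\<^sup>/\<^sup>2\<close>. In the type II sum, split dyadically, the
  Cauchy--Schwarz inequality is applied with the truncated divisor sums \<open>\<Sum> \<mu>(d)\<close> outside; their mean
  square is \<open>O((log X)\<^sup>2)\<close>, because \<open>\<Sum> \<mu>(m) / m\<close> over \<open>m\<close> coprime to a fixed integer stays bounded. Both
  sums are then reduced to sums of \<open>min(Z, 1 / \<parallel>\<alpha> m\<parallel>)\<close>, estimated by the spacing of the \<open>\<alpha> m\<close> modulo 1.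
\<close>

section \<open>The Moebius function and squarefull numbers\<close>

text \<open>The exponent 5/2 is reached exactly on two sides. In type I the Cauchy--Schwarz
  inequality pairs \<Sum> d(w)^2 / w, of size (log X)^4, with a kernel sum that carries one more
  logarithm. In type II a dyadic block costs the square root of (log X)^2, from the mean square,
  times log X, from the kernel; about log X blocks turn this 3/2 into 5/2. The mean square (log X)^3
  of the divisor function would lead to exponent 3. The exponent 5/6 is forced by the cut-off c:
  type I contributes sqrt(X c^2) and type II sqrt(X (X / c)), equal for c = X^(1/3), and the trivial
  bound c sqrt X for the squarefull term then has the same size up to a logarithm. This concerns q
  \<le> X only; for larger q the term with q^(1/2) exceeds the trivial bound X, which rests on
  |mu_hat| \<le> 1.\<close>

lemma finite_divisors_restricted [simp]: "n > 0 \<Longrightarrow> finite {d::nat. d dvd n \<and> P d}"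
  by (rule finite_subset[of _ "{d. d dvd n}"]) auto

text \<open>Writing S as A together with a subset T of B - A, the sum over T is the expansion of a
  product of factors 1 - 1, which vanishes unless B - A is empty.\<close>

lemma sum_signs_subsets_between:
  assumes "finite B" "A \<subseteq> B"
  shows "(\<Sum>S | A \<subseteq> S \<and> S \<subseteq> B. (-1) ^ card S) = (if A = B then (-1) ^ card A else (0::int))"
proof -
  have "(\<Sum>S | A \<subseteq> S \<and> S \<subseteq> B. (-1) ^ card S) = (\<Sum>T\<in>Pow (B - A). (-1) ^ card (A \<union> T) :: int)"
    using assms by (intro sum.reindex_bij_witness[of _ "\<lambda>T. A \<union> T" "\<lambda>S. S - A"])
      (auto simp: Un_absorb1)
  also have "\<dots> = (\<Sum>T\<in>Pow (B - A). (-1) ^ card A * (-1) ^ card T)"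
  proof (intro sum.cong refl)
    fix T assume "T \<in> Pow (B - A)"
    then have "card (A \<union> T) = card A + card T"
      using assms by (intro card_Un_disjoint) (auto intro: finite_subset)
    then show "(-1) ^ card (A \<union> T) = (-1) ^ card A * ((-1) ^ card T :: int)" by (simp add: power_add)
  qed
  also have "\<dots> = (-1) ^ card A * (\<Prod>x\<in>B - A. (1::int) - 1)"
    using assms by (subst prod_diff_conv_sum) (auto simp: sum_distrib_left)
  also have "\<dots> = (if A = B then (-1) ^ card A else 0)"
    using assms by auto
  finally show ?thesis .
qed

lemma prime_factors_prod_primes:
  fixes S :: "nat set"
  assumes "finite S" "\<And>p. p \<in> S \<Longrightarrow> prime p"
  shows "prime_factors (\<Prod>S) = S"
proof -
  have "0 \<notin> S" using assms(2)[of 0] by auto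
  then have "\<Prod>S \<noteq> 0" using assms(1) by simp
  moreover have "p dvd \<Prod>S \<longleftrightarrow> p \<in> S" if "prime p" for p
    using prime_dvd_prod_iff[OF assms(1) that, of "\<lambda>x. x"] assms(2) that
    by (metis dvd_refl primes_dvd_imp_eq)
  ultimately show ?thesis using assms by (auto simp: prime_factors_dvd)
qed

lemma multiplicity_prod_primes:
  fixes S :: "nat set"
  assumes "finite S" "\<And>p. p \<in> S \<Longrightarrow> prime p" "prime p"
  shows "multiplicity p (\<Prod>S) = of_bool (p \<in> S)"
  using multiplicity_prod_prime_powers[of S p "\<lambda>_. 1"] assms by auto

lemma squarefree_prod_primes:
  fixes S :: "nat set"
  assumes "finite S" "\<And>p. p \<in> S \<Longrightarrow> prime p"
  shows "squarefree (\<Prod>S)"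
proof -
  have "0 \<notin> S" using assms(2)[of 0] by auto
  then have "\<Prod>S \<noteq> 0" using assms(1) by simp
  then show ?thesis using assms
    by (auto simp: squarefree_factorial_semiring'' multiplicity_prod_primes)
qed

lemma prod_prime_factors_squarefree:
  fixes d :: nat
  assumes "squarefree d"
  shows "\<Prod>(prime_factors d) = d"
proof -
  have d: "d \<noteq> 0" using assms by (intro notI) simp
  have "multiplicity p (\<Prod>(prime_factors d)) = multiplicity p d" if p: "prime p" for p
  proof -
    have "multiplicity p d \<le> 1" using assms p d by (simp add: squarefree_factorial_semiring'')
    moreover have "multiplicity p d > 0 \<longleftrightarrow> p \<in> prime_factors d"
      using p d by (simp add: prime_factors_multiplicity)
    ultimately show ?thesis using p by (subst multiplicity_prod_primes) auto
  qed
  moreover have "0 \<notin> prime_factors d" by auto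
  then have "\<Prod>(prime_factors d) \<noteq> 0" by simp
  ultimately show ?thesis using d by - (rule multiplicity_eq_nat, simp_all add: prime_gt_0_nat in_prime_factors_iff)
qed

section \<open>Moebius sums over divisors\<close>

text \<open>Only squarefree divisors contribute, and these correspond to sets of primes dividing n.
  The filter P is left free because it serves both for coprimality to a fixed integer and for a
  squarefull cofactor.\<close>

lemma sum_mobius_mu_divisors:
  assumes n: "n > 0"
  shows "(\<Sum>d | d dvd n \<and> P d. mobius_mu d) =
         (\<Sum>S | S \<subseteq> prime_factors n \<and> P (\<Prod>S). (-1) ^ card S)"
proof -
  have "(\<Sum>d | d dvd n \<and> P d. mobius_mu d) = (\<Sum>d | d dvd n \<and> P d \<and> squarefree d. mobius_mu d)"
    using n by (intro sum.mono_neutral_right) (auto simp: mobius_mu_def)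
  also have "\<dots> = (\<Sum>S | S \<subseteq> prime_factors n \<and> P (\<Prod>S). (-1) ^ card S)"
  proof (rule sum.reindex_bij_witness[of _ "\<lambda>S. \<Prod>S" "prime_factors"])
    fix S assume "S \<in> {S. S \<subseteq> prime_factors n \<and> P (\<Prod>S)}"
    then have S: "S \<subseteq> prime_factors n" "P (\<Prod>S)" "finite S" "\<And>p. p \<in> S \<Longrightarrow> prime p"
      by (auto intro: finite_subset)
    show "prime_factors (\<Prod>S) = S" using S by (simp add: prime_factors_prod_primes)
    have "\<Prod>S dvd n"
    proof -
      have "multiplicity p (\<Prod>S) \<le> multiplicity p n" if "prime p" for p
        using S n that
        by (subst multiplicity_prod_primes) (auto simp: prime_factors_multiplicity Suc_leI)
      then show ?thesis
        using S n by (intro multiplicity_le_imp_dvd) (auto simp: prime_gt_0_nat)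
    qed
    then show "\<Prod>S \<in> {d. d dvd n \<and> P d \<and> squarefree d}"
      using S by (auto intro: squarefree_prod_primes)
  next
    fix d assume "d \<in> {d. d dvd n \<and> P d \<and> squarefree d}"
    then show "\<Prod>(prime_factors d) = d" "prime_factors d \<in> {S. S \<subseteq> prime_factors n \<and> P (\<Prod>S)}"
      "(-1) ^ card (prime_factors d) = mobius_mu d"
      using n by (auto simp: prod_prime_factors_squarefree mobius_mu_def dvd_prime_factors prime_factors_dvd)
  qed
  finally show ?thesis .
qed

text \<open>Coprimality of a product to d is decided prime by prime, so the admissible sets are all
  subsets of one set of primes and the signs cancel unless that set is empty. The right-hand side
  says that every prime factor of n divides d.\<close>

lemma sum_mobius_mu_coprime_divisors:
  assumes n: "n > 0"
  shows "(\<Sum>m | m dvd n \<and> coprime m d. mobius_mu m)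
         = of_bool ({p \<in> prime_factors n. coprime p d} = {})"
proof -
  have "(\<Sum>m | m dvd n \<and> coprime m d. mobius_mu m)
        = (\<Sum>S | S \<subseteq> prime_factors n \<and> coprime (\<Prod>S) d. (-1) ^ card S)"
    by (rule sum_mobius_mu_divisors[OF n])
  also have "{S. S \<subseteq> prime_factors n \<and> coprime (\<Prod>S) d}
             = {S. {} \<subseteq> S \<and> S \<subseteq> {p \<in> prime_factors n. coprime p d}}"
  proof -
    have "coprime (\<Prod>S) d \<longleftrightarrow> (\<forall>p\<in>S. coprime p d)" if "S \<subseteq> prime_factors n" for S
    proof -
      have "finite S" using that by (auto intro: finite_subset)
      then show ?thesis by (induction S) auto
    qed
    then show ?thesis by auto
  qed
  also have "(\<Sum>S\<in>\<dots>. (-1) ^ card S) = (of_bool ({p \<in> prime_factors n. coprime p d} = {}) :: int)"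
    by (subst sum_signs_subsets_between) auto
  finally show ?thesis .
qed

lemma sum_mobius_mu:
  assumes n: "n > 0"
  shows "(\<Sum>m | m dvd n. mobius_mu m) = of_bool (n = 1)"
  using sum_mobius_mu_coprime_divisors[OF n, of 1] n
  by (auto simp: prime_factorization_empty_iff)

lemma abs_mobius_mu_le_1: "\<bar>mobius_mu n\<bar> \<le> 1"
  by (simp add: mobius_mu_def)

lemma mobius_mu_mult_coprime:
  assumes "coprime a b"
  shows "mobius_mu (a * b) = mobius_mu a * mobius_mu b"
proof (cases "squarefree a \<and> squarefree b")
  case True
  then have "a \<noteq> 0" "b \<noteq> 0" using not_squarefree_0[where ?'a = nat] by metis+
  have "prime_factors a \<inter> prime_factors b = {}"
    using assms coprime_common_divisor_nat[of a b] by (auto simp: in_prime_factors_iff) (metis One_nat_def not_prime_1)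
  then show ?thesis using True assms \<open>a \<noteq> 0\<close> \<open>b \<noteq> 0\<close>
    by (simp add: mobius_mu_def squarefree_mult_coprime prime_factors_product card_Un_disjoint power_add)
next
  case False
  then show ?thesis using squarefree_multD[of a b] by (auto simp: mobius_mu_def)
qed

lemma squarefull_iff_multiplicity:
  assumes "n > 0"
  shows "squarefull n \<longleftrightarrow> (\<forall>p. prime p \<longrightarrow> multiplicity p n \<noteq> 1)"
proof -
  have "(p dvd n \<longrightarrow> p\<^sup>2 dvd n) \<longleftrightarrow> multiplicity p n \<noteq> 1" if p: "prime p" for p
  proof -
    have "p dvd n \<longleftrightarrow> multiplicity p n \<ge> 1"
      using p assms power_dvd_iff_le_multiplicity[of n p 1] prime_gt_1_nat[OF p] by simp
    moreover have "p\<^sup>2 dvd n \<longleftrightarrow> multiplicity p n \<ge> 2"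
      using p assms power_dvd_iff_le_multiplicity[of n p 2] prime_gt_1_nat[OF p] by simp
    ultimately show ?thesis by linarith
  qed
  then show ?thesis using assms by (auto simp: squarefull_def)
qed

text \<open>A squarefree divisor of \<open>n\<close> with squarefull cofactor is a set of primes that contains those of
  exponent 1 in \<open>n\<close>, avoids those of exponent 2, and is unconstrained at higher exponents; so the
  sum of signs defining \<open>mu_hat n\<close> collapses to a single term or cancels.\<close>
lemma abs_mu_hat_le_1:
  assumes n: "n > 0"
  shows "\<bar>mu_hat n\<bar> \<le> 1"
proof -
  define A where "A = {p \<in> prime_factors n. multiplicity p n = 1}"
  define B where "B = {p \<in> prime_factors n. multiplicity p n \<noteq> 2}"
  have "mu_hat n = (\<Sum>d | d dvd n \<and> squarefull (n div d). mobius_mu d)"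
    unfolding mu_hat_def dirichlet_conv_def using n
    by (intro sum.mono_neutral_cong_right) auto
  also have "\<dots> = (\<Sum>S | S \<subseteq> prime_factors n \<and> squarefull (n div \<Prod>S). (-1) ^ card S)"
    by (rule sum_mobius_mu_divisors[OF n])
  also have "{S. S \<subseteq> prime_factors n \<and> squarefull (n div \<Prod>S)} = {S. A \<subseteq> S \<and> S \<subseteq> B}"
  proof -
    have "squarefull (n div \<Prod>S) \<longleftrightarrow> A \<subseteq> S \<and> S \<subseteq> B" if S: "S \<subseteq> prime_factors n" for S
    proof -
      have S': "finite S" "\<And>p. p \<in> S \<Longrightarrow> prime p" using S by (auto intro: finite_subset)
      have mult: "multiplicity p (\<Prod>S) = of_bool (p \<in> S)" if "prime p" for p
        using S' that by (rule multiplicity_prod_primes)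
      have "0 \<notin> S" using S'(2)[of 0] by auto
      then have nz: "\<Prod>S \<noteq> 0" using S'(1) by simp
      have "\<Prod>S dvd n"
        using S nz n mult
        by (intro multiplicity_le_imp_dvd) (auto simp: prime_factors_multiplicity Suc_leI)
      then obtain k where k: "n = \<Prod>S * k" by blast
      then have "k > 0" using n by (auto intro: Nat.gr0I)
      have "multiplicity p n = of_bool (p \<in> S) + multiplicity p k" if "prime p" for p
        unfolding k using that nz \<open>k > 0\<close>
        by (subst prime_elem_multiplicity_mult_distrib) (auto simp: mult)
      moreover have "n div \<Prod>S = k" using k nz by simp
      ultimately have "squarefull (n div \<Prod>S) \<longleftrightarrow>
          (\<forall>p. prime p \<longrightarrow> multiplicity p n \<noteq> of_bool (p \<in> S) + 1)"
        using \<open>k > 0\<close> by (simp add: squarefull_iff_multiplicity)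
      also have "\<dots> \<longleftrightarrow> A \<subseteq> S \<and> S \<subseteq> B"
        using S S' unfolding A_def B_def
        by (auto simp: prime_factors_multiplicity split: if_splits)
      finally show ?thesis .
    qed
    moreover have "S \<subseteq> prime_factors n" if "S \<subseteq> B" for S
      using that by (auto simp: B_def)
    ultimately show ?thesis by blast
  qed
  also have "(\<Sum>S\<in>\<dots>. (-1) ^ card S) = (if A = B then (-1) ^ card A else (0::int))"
    by (rule sum_signs_subsets_between) (auto simp: A_def B_def)
  finally show ?thesis by auto
qed

text \<open>Both sides run over the pairs whose product c d divides n.\<close>

lemma sum_divisors_complement_swap:
  fixes g :: "nat \<Rightarrow> nat \<Rightarrow> 'a::comm_monoid_add"
  assumes n: "n > 0"
  shows "(\<Sum>c | c dvd n. \<Sum>d | d dvd n div c. g c d) = (\<Sum>d | d dvd n. \<Sum>c | c dvd n div d. g c d)"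
proof -
  have iff: "c dvd n \<and> d dvd n div c \<longleftrightarrow> d dvd n \<and> c dvd n div d" for c d
    using n by (metis dvd_div_iff_mult dvd_mult_left dvd_mult_right mult.commute not_less0 dvd_0_left_iff)
  have "(\<Sum>c | c dvd n. \<Sum>d | d dvd n div c. g c d)
        = (\<Sum>(c,d)\<in>{(c,d). c dvd n \<and> d dvd n div c}. g c d)"
    using n by (subst sum.Sigma) (auto intro!: sum.cong simp: dvd_div_eq_0_iff)
  also have "\<dots> = (\<Sum>(d,c)\<in>{(d,c). d dvd n \<and> c dvd n div d}. g c d)"
    using iff by (intro sum.reindex_bij_witness[of _ "\<lambda>(d,c). (c,d)" "\<lambda>(c,d). (d,c)"]) auto
  also have "\<dots> = (\<Sum>d | d dvd n. \<Sum>c | c dvd n div d. g c d)"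
    using n by (subst sum.Sigma) (auto intro!: sum.cong simp: dvd_div_eq_0_iff)
  finally show ?thesis .
qed

text \<open>When g splits as a product u(d) v(c), this is the regrouping 1 * (u * v) = (1 * u) * v,
  obtained from m = c d.\<close>

lemma sum_divisors_divisors:
  fixes g :: "nat \<Rightarrow> nat \<Rightarrow> 'a::comm_monoid_add"
  assumes n: "n > 0"
  shows "(\<Sum>m | m dvd n. \<Sum>d | d dvd m. g d (m div d)) = (\<Sum>c | c dvd n. \<Sum>d | d dvd n div c. g d c)"
proof -
  have "(\<Sum>m | m dvd n. \<Sum>d | d dvd m. g d (m div d))
        = (\<Sum>(m,d)\<in>{(m,d). m dvd n \<and> d dvd m}. g d (m div d))"
    using n by (subst sum.Sigma) (auto intro!: sum.cong intro: dvd_pos_nat)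
  also have "\<dots> = (\<Sum>(c,d)\<in>{(c,d). c dvd n \<and> d dvd n div c}. g d c)"
    using n
    by (intro sum.reindex_bij_witness[of _ "\<lambda>(c,d). (c * d, d)" "\<lambda>(m,d). (m div d, d)"])
      (auto elim!: dvdE)
  also have "\<dots> = (\<Sum>c | c dvd n. \<Sum>d | d dvd n div c. g d c)"
    using n by (subst sum.Sigma) (auto intro!: sum.cong simp: dvd_div_eq_0_iff)
  finally show ?thesis .
qed

lemma sum_mu_hat_divisors:
  assumes n: "n > 0"
  shows "(\<Sum>m | m dvd n. mu_hat m) = of_bool (squarefull n)"
proof -
  have "(\<Sum>m | m dvd n. mu_hat m)
        = (\<Sum>c | c dvd n. \<Sum>d | d dvd n div c. mobius_mu d * of_bool (squarefull c))"
    unfolding mu_hat_def dirichlet_conv_def by (rule sum_divisors_divisors[OF n])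
  also have "\<dots> = (\<Sum>c | c dvd n. of_bool (n div c = 1) * of_bool (squarefull c))"
    using n by (intro sum.cong refl, subst sum_distrib_right[symmetric], subst sum_mobius_mu)
      (auto intro: Nat.gr0I simp: dvd_div_eq_0_iff)
  also have "\<dots> = (\<Sum>c\<in>{n}. of_bool (squarefull c))"
    using n by (intro sum.mono_neutral_cong_right) (auto elim!: dvdE)
  finally show ?thesis by simp
qed

section \<open>Mean values of divisor sums\<close>

lemma sum_inverse_le_ln:
  assumes "n \<ge> 1"
  shows "(\<Sum>k=1..n. 1 / real k) \<le> 1 + ln (real n)"
proof -
  have "harm (Suc (n - 1)) - ln (real (Suc (n - 1))) \<le> harm (Suc 0) - ln (real (Suc 0))"
    using decseq_harm_diff_ln by (rule decseqD) simp
  then show ?thesis using assms by (simp add: harm_def inverse_eq_divide)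
qed

text \<open>Regrouping by n = m k. This is the passage from a summed Dirichlet convolution to a
  double sum under the hyperbola, used for all mean values and for all terms of Vaughan's
  identity.\<close>

lemma sum_sum_divisors:
  fixes g :: "nat \<Rightarrow> nat \<Rightarrow> 'a::comm_monoid_add"
  shows "(\<Sum>n=1..N. \<Sum>m | m dvd n. g m (n div m)) = (\<Sum>m=1..N. \<Sum>k=1..N div m. g m k)"
proof -
  have "(\<Sum>n=1..N. \<Sum>m | m dvd n. g m (n div m))
        = (\<Sum>(n,m)\<in>(SIGMA n:{1..N}. {m. m dvd n}). g m (n div m))"
    by (subst sum.Sigma) auto
  also have "\<dots> = (\<Sum>(m,k)\<in>(SIGMA m:{1..N}. {1..N div m}). g m k)"
  proof (rule sum.reindex_bij_witness[of _ "\<lambda>(m,k). (m * k, m)" "\<lambda>(n,m). (m, n div m)"], goal_cases)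
    case (2 a)
    then obtain y k where "a = (y * k, y)" "Suc 0 \<le> y" "Suc 0 \<le> k" "y * k \<le> N"
      by (auto elim!: dvdE simp: Suc_le_eq)
    moreover from this have "y \<le> N"
      by (metis One_nat_def le_trans mult.right_neutral mult_le_mono2)
    ultimately show ?case by (auto simp: less_eq_div_iff_mult_less_eq mult.commute)
  next
    case (4 b)
    then show ?case by (auto simp: less_eq_div_iff_mult_less_eq mult.commute intro: Suc_leI)
  qed (auto simp: Suc_le_eq)
  also have "\<dots> = (\<Sum>m=1..N. \<Sum>k=1..N div m. g m k)"
    by (subst sum.Sigma) auto
  finally show ?thesis .
qed

lemma real_div_bounds:
  assumes "m > 0"
  shows "real (n div m) \<le> real n / real m" "\<bar>real n / real m - real (n div m)\<bar> \<le> 1"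
proof -
  have "real n = real m * real (n div m) + real (n mod m)"
    by (metis div_mult_mod_eq mult.commute of_nat_add of_nat_mult)
  moreover have "real (n mod m) < real m" using assms by simp
  ultimately show "real (n div m) \<le> real n / real m" "\<bar>real n / real m - real (n div m)\<bar> \<le> 1"
    using assms by (auto simp: field_simps abs_le_iff)
qed

text \<open>Weighted with \<open>Y div m\<close> instead of Y / m, the sum counts the n \<le> Y all
  of whose primes divide d, so it lies between 0 and Y. Replacing the floors costs at most 1 for
  each m; dividing the total 2 Y by Y gives a bound uniform in d.\<close>

lemma abs_sum_mobius_mu_coprime_over_le:
  "\<bar>\<Sum>m=1..Y. of_bool (coprime m d) * of_int (mobius_mu m) / real m\<bar> \<le> 2"
proof (cases "Y = 0")
  case False
  define a where "a m = of_bool (coprime m d) * real_of_int (mobius_mu m)" for m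
  have a_le: "\<bar>a m\<bar> \<le> 1" for m
    using abs_mobius_mu_le_1[of m] by (auto simp: a_def simp flip: of_int_abs)
  have "(\<Sum>m=1..Y. a m * real (Y div m)) = (\<Sum>n=1..Y. \<Sum>m | m dvd n. a m)"
    by (subst sum_sum_divisors) (simp add: mult.commute)
  also have "\<dots> = (\<Sum>n=1..Y. of_bool ({p \<in> prime_factors n. coprime p d} = {}))"
  proof (intro sum.cong refl)
    fix n assume "n \<in> {1..Y}"
    then have n: "n > 0" by simp
    have "(\<Sum>m | m dvd n. a m) = (\<Sum>m | m dvd n \<and> coprime m d. real_of_int (mobius_mu m))"
      using n by (intro sum.mono_neutral_cong_right) (auto simp: a_def)
    also have "\<dots> = real_of_int (\<Sum>m | m dvd n \<and> coprime m d. mobius_mu m)" by simp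
    finally show "(\<Sum>m | m dvd n. a m) = of_bool ({p \<in> prime_factors n. coprime p d} = {})"
      by (subst (asm) sum_mobius_mu_coprime_divisors[OF n]) simp
  qed
  finally have 1: "(\<Sum>m=1..Y. a m * real (Y div m))
      = (\<Sum>n=1..Y. of_bool ({p \<in> prime_factors n. coprime p d} = {}))" .
  have "\<bar>\<Sum>m=1..Y. a m * real (Y div m)\<bar> \<le> (\<Sum>n=1..Y. 1)"
    unfolding 1 by (intro order.trans[OF sum_abs] sum_mono) auto
  moreover have "\<bar>\<Sum>m=1..Y. a m * (real Y / real m - real (Y div m))\<bar> \<le> (\<Sum>m=1..Y. 1)"
  proof (intro order.trans[OF sum_abs] sum_mono)
    fix m assume "m \<in> {1..Y}"
    then show "\<bar>a m * (real Y / real m - real (Y div m))\<bar> \<le> 1"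
      unfolding abs_mult using a_le real_div_bounds(2)[of m Y] by (intro mult_le_one) auto
  qed
  moreover have "real Y * (\<Sum>m=1..Y. a m / real m)
      = (\<Sum>m=1..Y. a m * real (Y div m)) + (\<Sum>m=1..Y. a m * (real Y / real m - real (Y div m)))"
    by (simp add: sum_distrib_left sum.distrib[symmetric] algebra_simps)
  ultimately have "\<bar>real Y * (\<Sum>m=1..Y. a m / real m)\<bar> \<le> 2 * real Y" by simp
  then have "real Y * \<bar>\<Sum>m=1..Y. a m / real m\<bar> \<le> real Y * 2" by (simp add: abs_mult)
  then show ?thesis using False by (simp add: a_def)
qed auto

text \<open>The preceding bound, taken up to \<open>min K V\<close>, gives 2 K; restoring the floors
  costs at most another K. No logarithm enters, whatever d and V are.\<close>

lemma abs_sum_mobius_mu_coprime_div_le: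
  "\<bar>\<Sum>m=1..K. of_bool (coprime m d \<and> m \<le> V) * real_of_int (mobius_mu m) * real (K div m)\<bar>
   \<le> 3 * real K"
proof -
  define a where "a m = of_bool (coprime m d) * real_of_int (mobius_mu m)" for m
  have a_le: "\<bar>a m\<bar> \<le> 1" for m
    using abs_mobius_mu_le_1[of m] by (auto simp: a_def simp flip: of_int_abs)
  have "(\<Sum>m=1..K. of_bool (coprime m d \<and> m \<le> V) * real_of_int (mobius_mu m) * real (K div m))
        = (\<Sum>m=1..min K V. a m * real (K div m))"
    by (intro sum.mono_neutral_cong_right) (auto simp: a_def)
  also have "\<dots> = real K * (\<Sum>m=1..min K V. a m / real m)
      - (\<Sum>m=1..min K V. a m * (real K / real m - real (K div m)))"
    by (simp add: sum_distrib_left sum_subtractf[symmetric] algebra_simps)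
  also have "\<bar>\<dots>\<bar> \<le> real K * 2 + real (min K V)"
  proof -
    have "\<bar>real K * (\<Sum>m=1..min K V. a m / real m)\<bar> \<le> real K * 2"
      unfolding abs_mult using abs_sum_mobius_mu_coprime_over_le[where Y = "min K V" and d = d]
      by (intro mult_mono) (auto simp: a_def)
    moreover have "\<bar>\<Sum>m=1..min K V. a m * (real K / real m - real (K div m))\<bar> \<le> (\<Sum>m=1..min K V. 1)"
    proof (intro order.trans[OF sum_abs] sum_mono)
      fix m assume "m \<in> {1..min K V}"
      then show "\<bar>a m * (real K / real m - real (K div m))\<bar> \<le> 1"
        unfolding abs_mult using a_le real_div_bounds(2)[of m K] by (intro mult_le_one) auto
    qed
    ultimately show ?thesis by simp
  qed
  finally show ?thesis by simp
qed

section \<open>Truncated Moebius divisor sums and their mean square\<close>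

definition mobius_trunc :: "nat \<Rightarrow> nat \<Rightarrow> int" where
  "mobius_trunc V n = (\<Sum>d | d dvd n \<and> d \<le> V. mobius_mu d)"

text \<open>A squarefree divisor of d k splits uniquely as g m, where g is its gcd with d and m is a
  divisor of k coprime to d; the Moebius function is multiplicative on this splitting. This isolates
  sums over m coprime to d, which are bounded without a logarithm. Squarefreeness of d makes every g
  squarefree.\<close>

lemma mobius_trunc_mult:
  assumes d: "squarefree d" and k: "k > 0"
  shows "mobius_trunc V (d * k) = (\<Sum>g | g dvd d. mobius_mu g *
           (\<Sum>m | m dvd k. of_bool (coprime m d \<and> m \<le> V div g) * mobius_mu m))"
proof -
  have d0: "d > 0" using d by (intro Nat.gr0I) simp
  have "mobius_trunc V (d * k) = (\<Sum>e | e dvd d * k \<and> e \<le> V \<and> squarefree e. mobius_mu e)"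
    unfolding mobius_trunc_def using d0 k
    by (intro sum.mono_neutral_right) (auto simp: mobius_mu_def)
  also have "\<dots> = (\<Sum>(g,m)\<in>(SIGMA g:{g. g dvd d}. {m. m dvd k \<and> coprime m d \<and> m \<le> V div g \<and> squarefree m}).
      mobius_mu g * mobius_mu m)"
  proof (rule sum.reindex_bij_witness[of _ "\<lambda>(g,m). g * m" "\<lambda>e. (gcd e d, e div gcd e d)"], goal_cases)
    case (2 e)
    define g where "g = gcd e d"
    define m where "m = e div g"
    have e: "e dvd d * k" "e \<le> V" "squarefree e" using 2 by auto
    have g0: "g > 0" using d0 by (simp add: g_def)
    have em: "e = g * m" unfolding m_def g_def by simp
    have sq: "squarefree m" "coprime g m"
      using e(3) squarefree_multD[of g m] unfolding em
      by (auto simp: coprime_iff_gcd_eq_1 dest!: squarefreeD[of _ "gcd g m"]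
            simp: power2_eq_square mult_dvd_mono)
    have "coprime m (d div g)"
      using d0 unfolding m_def g_def by (intro div_gcd_coprime) auto
    then have cop: "coprime m (g * (d div g))" using sq by (simp add: coprime_commute)
    have "g * (d div g) = d" unfolding g_def by simp
    with cop have cop: "coprime m d" by simp
    moreover have "m dvd k"
      using e(1) cop unfolding em by (metis coprime_dvd_mult_right_iff dvd_mult_right)
    moreover have "m \<le> V div g" using e(2) g0 unfolding em
      by (simp add: less_eq_div_iff_mult_less_eq mult.commute)
    ultimately show ?case using sq unfolding g_def[symmetric] m_def[symmetric]
      by (auto simp: g_def)
  next
    case (3 x)
    then obtain g m where x: "x = (g, m)" and gm: "g dvd d" "m dvd k" "coprime m d" by auto
    have g0: "g > 0" using gm d0 by (auto intro: Nat.gr0I)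
    have "gcd (g * m) d = g"
      using gm by (metis gcd_mult_left_right_cancel gcd_nat.absorb1 coprime_commute)
    then show ?case using g0 by (simp add: x)
  next
    case (4 x)
    then obtain g m where x: "x = (g, m)" and gm: "g dvd d" "m dvd k" "coprime m d" 
      "m \<le> V div g" "squarefree m" by auto
    have g0: "g > 0" using gm d0 by (auto intro: Nat.gr0I)
    have "coprime g m" using gm by (metis coprime_commute coprime_divisors dvd_refl)
    moreover have "squarefree g" using gm d squarefree_mono by blast
    ultimately show ?case using gm g0
      by (auto simp: x mult_dvd_mono less_eq_div_iff_mult_less_eq mult.commute squarefree_mult_coprime)
  next
    case (5 e)
    then have e: "squarefree e" by auto
    have em: "e = gcd e d * (e div gcd e d)" by simp
    have "coprime (gcd e d) (e div gcd e d)"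
      using squarefreeD[of e "gcd (gcd e d) (e div gcd e d)"] e em
      by (metis coprime_iff_gcd_eq_1 gcd_dvd1 gcd_dvd2 mult_dvd_mono nat_dvd_1_iff_1 power2_eq_square)
    then show ?case using mobius_mu_mult_coprime em by (metis case_prod_conv)
  qed auto
  also have "\<dots> = (\<Sum>g | g dvd d. mobius_mu g *
           (\<Sum>m | m dvd k \<and> coprime m d \<and> m \<le> V div g \<and> squarefree m. mobius_mu m))"
    using d0 k by (subst sum.Sigma[symmetric]) (auto simp: sum_distrib_left)
  also have "\<dots> = (\<Sum>g | g dvd d. mobius_mu g *
           (\<Sum>m | m dvd k. of_bool (coprime m d \<and> m \<le> V div g) * mobius_mu m))"
    using k by (intro sum.cong refl arg_cong2[where f = "(*)"] sum.mono_neutral_cong_left)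
      (auto simp: mobius_mu_def)
  finally show ?thesis .
qed

text \<open>Each divisor g of d contributes at most 3 K once the sum over k is carried out inside. A
  termwise estimate would lose a logarithm here.\<close>

lemma abs_sum_mobius_trunc_multiples_le:
  assumes d: "squarefree d"
  shows "\<bar>\<Sum>k=1..K. real_of_int (mobius_trunc V (d * k))\<bar> \<le> real (card {g. g dvd d}) * (3 * real K)"
proof -
  have d0: "d > 0" using d by (intro Nat.gr0I) simp
  have "(\<Sum>k=1..K. real_of_int (mobius_trunc V (d * k))) =
    (\<Sum>k=1..K. \<Sum>g | g dvd d. real_of_int (mobius_mu g) *
      (\<Sum>m | m dvd k. of_bool (coprime m d \<and> m \<le> V div g) * real_of_int (mobius_mu m)))"
    using d by (intro sum.cong refl, subst mobius_trunc_mult) auto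
  also have "\<dots> = (\<Sum>g | g dvd d. real_of_int (mobius_mu g) * (\<Sum>k=1..K. 
      \<Sum>m | m dvd k. of_bool (coprime m d \<and> m \<le> V div g) * real_of_int (mobius_mu m)))"
    by (subst sum.swap) (simp only: sum_distrib_left)
  also have "\<dots> = (\<Sum>g | g dvd d. real_of_int (mobius_mu g) * (\<Sum>m=1..K. 
      of_bool (coprime m d \<and> m \<le> V div g) * real_of_int (mobius_mu m) * real (K div m)))"
    by (subst sum_sum_divisors) (simp add: mult_ac)
  also have "\<bar>\<dots>\<bar> \<le> (\<Sum>g | g dvd d. 3 * real K)"
  proof (intro order.trans[OF sum_abs] sum_mono)
    fix g
    show "\<bar>real_of_int (mobius_mu g) * (\<Sum>m=1..K. 
      of_bool (coprime m d \<and> m \<le> V div g) * real_of_int (mobius_mu m) * real (K div m))\<bar> \<le> 3 * real K"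
      unfolding abs_mult
      using mult_mono[OF _ abs_sum_mobius_mu_coprime_div_le, of "\<bar>real_of_int (mobius_mu g)\<bar>" 1 d "V div g" K]
        abs_mobius_mu_le_1[of g]
      by (simp flip: of_int_abs)
  qed
  finally show ?thesis by simp
qed

text \<open>The divisor count is opened as the number of factorisations d = g k, and the constraint
  g k \<le> N is relaxed to g, k \<le> N.\<close>

lemma sum_card_divisors_over_le:
  "(\<Sum>d=1..N. real (card {g. g dvd d}) / real d) \<le> (\<Sum>k=1..N. 1 / real k)\<^sup>2"
proof -
  have "(\<Sum>d=1..N. real (card {g. g dvd d}) / real d)
        = (\<Sum>d=1..N. \<Sum>g | g dvd d. 1 / (real g * real (d div g)))"
    by (intro sum.cong refl) (auto simp flip: of_nat_mult)
  also have "\<dots> = (\<Sum>g=1..N. \<Sum>k=1..N div g. 1 / (real g * real k))"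
    by (rule sum_sum_divisors)
  also have "\<dots> \<le> (\<Sum>g=1..N. \<Sum>k=1..N. 1 / (real g * real k))"
    by (intro sum_mono sum_mono2) (auto intro: order.trans[OF _ div_le_dividend])
  also have "\<dots> = (\<Sum>k=1..N. 1 / real k)\<^sup>2"
    by (simp add: power2_eq_square sum_product)
  finally show ?thesis .
qed

lemma card_divisors_mult_le:
  assumes "a > 0" "b > (0::nat)"
  shows "card {g. g dvd a * b} \<le> card {g. g dvd a} * card {g. g dvd b}"
proof -
  have "{g. g dvd a * b} \<subseteq> (\<lambda>(x, y). x * y) ` ({g. g dvd a} \<times> {g. g dvd b})"
    using division_decomp[of _ a b] by force
  then have "card {g. g dvd a * b} \<le> card ({g. g dvd a} \<times> {g. g dvd b})"
    using assms by (intro surj_card_le) auto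
  then show ?thesis by (simp add: card_cartesian_product)
qed

text \<open>One factor of the square is opened as a sum over m = d k and the other is bounded by
  submultiplicativity. Relaxing d k \<le> N leaves the square of the sum of d(m) / m.\<close>

lemma sum_card_divisors_squared_over_le:
  "(\<Sum>m=1..N. (real (card {g. g dvd m}))\<^sup>2 / real m) \<le> (\<Sum>k=1..N. 1 / real k) ^ 4"
proof -
  define \<tau> where "\<tau> m = real (card {g. g dvd m})" for m :: nat
  have "(\<Sum>m=1..N. (\<tau> m)\<^sup>2 / real m) = (\<Sum>m=1..N. \<Sum>d | d dvd m. \<tau> (d * (m div d)) / real (d * (m div d)))"
    by (intro sum.cong refl) (simp add: power2_eq_square \<tau>_def)
  also have "\<dots> = (\<Sum>d=1..N. \<Sum>k=1..N div d. \<tau> (d * k) / real (d * k))"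
    by (rule sum_sum_divisors)
  also have "\<dots> \<le> (\<Sum>d=1..N. \<Sum>k=1..N div d. (\<tau> d / real d) * (\<tau> k / real k))"
  proof (intro sum_mono)
    fix d k assume "d \<in> {1..N}" "k \<in> {1..N div d}"
    then have "\<tau> (d * k) \<le> \<tau> d * \<tau> k"
      using card_divisors_mult_le[of d k] by (simp add: \<tau>_def flip: of_nat_mult)
    then show "\<tau> (d * k) / real (d * k) \<le> (\<tau> d / real d) * (\<tau> k / real k)"
      by (simp add: divide_right_mono)
  qed
  also have "\<dots> \<le> (\<Sum>d=1..N. \<Sum>k=1..N. (\<tau> d / real d) * (\<tau> k / real k))"
    by (intro sum_mono sum_mono2) (auto simp: \<tau>_def intro: order.trans[OF _ div_le_dividend])
  also have "\<dots> = (\<Sum>d=1..N. \<tau> d / real d)\<^sup>2"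
    by (simp add: power2_eq_square sum_product)
  also have "\<dots> \<le> ((\<Sum>k=1..N. 1 / real k)\<^sup>2)\<^sup>2"
    using sum_card_divisors_over_le[of N] by (intro power_mono) (auto simp: \<tau>_def intro!: sum_nonneg)
  finally show ?thesis by (simp add: \<tau>_def)
qed

text \<open>Only one of the two truncated divisor sums is expanded and estimated trivially; the cancellation
  in the other one saves a logarithm over the bound by the mean square of the divisor function. The
  exponent 5/2 of the theorem relies on this saving.\<close>
lemma sum_mobius_trunc_squared_le:
  assumes N: "N \<ge> 1"
  shows "(\<Sum>n=1..N. (real_of_int (mobius_trunc V n))\<^sup>2) \<le> 3 * real N * (1 + ln (real N))\<^sup>2"
proof -
  have "(\<Sum>n=1..N. (real_of_int (mobius_trunc V n))\<^sup>2)
      = (\<Sum>n=1..N. \<Sum>d | d dvd n. of_bool (d \<le> V) * real_of_int (mobius_mu d) * real_of_int (mobius_trunc V (d * (n div d))))"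
  proof (intro sum.cong refl)
    fix n assume "n \<in> {1..N}"
    then have n: "n > 0" by simp
    have "real_of_int (mobius_trunc V n) = (\<Sum>d | d dvd n. of_bool (d \<le> V) * real_of_int (mobius_mu d))"
      unfolding mobius_trunc_def of_int_sum using n by (intro sum.mono_neutral_cong_left) auto
    then show "(real_of_int (mobius_trunc V n))\<^sup>2 = (\<Sum>d | d dvd n. of_bool (d \<le> V) * real_of_int (mobius_mu d) * real_of_int (mobius_trunc V (d * (n div d))))"
      by (simp add: power2_eq_square sum_distrib_right)
  qed
  also have "\<dots> = (\<Sum>d=1..N. \<Sum>k=1..N div d. of_bool (d \<le> V) * real_of_int (mobius_mu d) * real_of_int (mobius_trunc V (d * k)))"
    by (rule sum_sum_divisors)
  also have "\<dots> \<le> (\<Sum>d=1..N. 3 * real N * (real (card {g. g dvd d}) / real d))"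
  proof (rule sum_mono)
    fix d assume d: "d \<in> {1..N}"
    let ?S = "\<Sum>k=1..N div d. real_of_int (mobius_trunc V (d * k))"
    have "(\<Sum>k=1..N div d. of_bool (d \<le> V) * real_of_int (mobius_mu d) * real_of_int (mobius_trunc V (d * k)))
       = of_bool (d \<le> V) * real_of_int (mobius_mu d) * ?S"
      by (simp add: sum_distrib_left)
    also have "\<dots> \<le> real (card {g. g dvd d}) * (3 * real (N div d))"
    \<comment> \<open>Outside the squarefree d, where the bound for multiples does not apply, the
      weight \<open>mobius_mu d\<close> vanishes.\<close>
    proof (cases "squarefree d")
      case True
      have "of_bool (d \<le> V) * real_of_int (mobius_mu d) * ?S \<le> \<bar>of_bool (d \<le> V) * real_of_int (mobius_mu d)\<bar> * \<bar>?S\<bar>"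
        by (metis abs_ge_self abs_mult)
      also have "\<dots> \<le> 1 * (real (card {g. g dvd d}) * (3 * real (N div d)))"
        using abs_mobius_mu_le_1[of d]
        by (intro mult_mono abs_sum_mobius_trunc_multiples_le True) (auto simp: simp flip: of_int_abs)
      finally show ?thesis by simp
    qed (auto simp: mobius_mu_def)
    also have "\<dots> \<le> real (card {g. g dvd d}) * (3 * (real N / real d))"
      using real_div_bounds(1)[of d N] d by (intro mult_left_mono) auto
    finally show "(\<Sum>k=1..N div d. of_bool (d \<le> V) * real_of_int (mobius_mu d) * real_of_int (mobius_trunc V (d * k)))
      \<le> 3 * real N * (real (card {g. g dvd d}) / real d)" by (simp add: mult_ac)
  qed
  also have "\<dots> = 3 * real N * (\<Sum>d=1..N. real (card {g. g dvd d}) / real d)"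
    by (simp add: sum_distrib_left)
  also have "\<dots> \<le> 3 * real N * (\<Sum>k=1..N. 1 / real k)\<^sup>2"
    by (intro mult_left_mono sum_card_divisors_over_le) auto
  also have "\<dots> \<le> 3 * real N * (1 + ln (real N))\<^sup>2"
    using sum_inverse_le_ln[OF N] by (intro mult_left_mono power_mono sum_nonneg) auto
  finally show ?thesis .
qed

section \<open>Counting squarefull numbers\<close>

text \<open>A prime of the squarefree part has odd exponent in n, hence exponent at least 3, so it
  also divides the square part.\<close>

lemma squarefree_part_dvd_square_part:
  assumes "squarefull n"
  shows "squarefree_part n dvd square_part n"
proof -
  have n: "n > 0" using assms by (simp add: squarefull_def)
  show ?thesis
  proof (rule multiplicity_le_imp_dvd)
    fix p :: nat assume p: "prime p"
    have "multiplicity p n \<noteq> 1" using assms n p by (simp add: squarefull_iff_multiplicity)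
    then show "multiplicity p (squarefree_part n) \<le> multiplicity p (square_part n)"
      using p by (simp add: prime_multiplicity_squarefree_part prime_multiplicity_square_part)
  qed simp
qed

text \<open>In n = a b^2 with a squarefree, b is at most sqrt N and a divides b, so there are at
  most as many n as pairs of some b \<le> sqrt N and a divisor of it. The logarithm is above the
  true order of magnitude but fits well within the exponent 5/2.\<close>

lemma card_squarefull_le:
  assumes N: "N \<ge> 1"
  shows "real (card {n\<in>{1..N}. squarefull n}) \<le> sqrt (real N) * (1 + ln (real N))"
proof -
  define R where "R = nat \<lfloor>sqrt (real N)\<rfloor>"
  have R: "real R \<le> sqrt (real N)" "R \<ge> 1" using N by (auto simp: R_def le_nat_floor)
  have "card {n\<in>{1..N}. squarefull n} \<le> card (SIGMA b:{1..R}. {a. a dvd b})"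
  proof (rule card_inj_on_le)
    show "inj_on (\<lambda>n. (square_part n, squarefree_part n)) {n\<in>{1..N}. squarefull n}"
      by (auto intro!: inj_onI squarefree_decomposition_unique)
    show "(\<lambda>n. (square_part n, squarefree_part n)) ` {n\<in>{1..N}. squarefull n} \<subseteq> (SIGMA b:{1..R}. {a. a dvd b})"
    proof safe
      fix n assume n: "n \<in> {1..N}" "squarefull n"
      have "square_part n ^ 2 \<le> n" using n by (intro dvd_imp_le) auto
      then have "square_part n ^ 2 \<le> N" using n by simp
      then have "real (square_part n) ^ 2 \<le> real N" by (metis of_nat_le_iff of_nat_power)
      then have "real (square_part n) \<le> sqrt (real N)" by (simp add: real_le_rsqrt)
      then show "square_part n \<in> {1..R}" using n by (auto simp: R_def le_nat_floor Suc_le_eq intro: Nat.gr0I)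
      show "squarefree_part n dvd square_part n" using n by (intro squarefree_part_dvd_square_part)
    qed
  qed auto
  also have "\<dots> = (\<Sum>b=1..R. card {a. a dvd b})" by (rule card_SigmaI) auto
  also have "\<dots> = (\<Sum>b=1..R. \<Sum>a | a dvd b. 1)" by simp
  also have "\<dots> = (\<Sum>a=1..R. R div a)" by (subst sum_sum_divisors) simp
  finally have "real (card {n\<in>{1..N}. squarefull n}) \<le> (\<Sum>a=1..R. real (R div a))"
    by (simp flip: of_nat_sum)
  also have "\<dots> \<le> (\<Sum>a=1..R. real R * (1 / real a))"
    using real_div_bounds(1) by (intro sum_mono) auto
  also have "\<dots> = real R * (\<Sum>a=1..R. 1 / real a)" by (simp add: sum_distrib_left)
  also have "\<dots> \<le> real R * (1 + ln (real R))"
    by (intro mult_left_mono sum_inverse_le_ln R) auto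
  also have "\<dots> \<le> sqrt (real N) * (1 + ln (real N))"
  proof -
    have "sqrt (real N) \<le> real N" using N by (intro real_le_lsqrt) (auto simp: power2_eq_square)
    then show ?thesis using R N by (intro mult_mono add_left_mono) auto
  qed
  finally show ?thesis .
qed

section \<open>Exponential sums and rational approximation\<close>

lemma norm_e [simp]: "norm (e x) = 1"
  by (simp add: e_def norm_exp_eq_Re)

lemma e_add: "e (x + y) = e x * e y"
  by (simp add: e_def exp_add[symmetric] algebra_simps)

lemma e_of_nat_mult: "e (real n * x) = e x ^ n"
  by (simp add: e_def exp_of_nat_mult[symmetric] mult_ac)

lemma e_of_int: "e (of_int k) = 1"
  using exp_integer_2pi[of "of_int k"] by (simp add: e_def mult_ac)

lemma cnj_e: "cnj (e x) = e (- x)"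
  by (simp add: e_def exp_cnj)

section \<open>Distance to the nearest integer and geometric sums\<close>

definition dist_int :: "real \<Rightarrow> real" where
  "dist_int x = \<bar>x - of_int (round x)\<bar>"

lemma dist_int_le_half: "dist_int x \<le> 1 / 2"
  using of_int_round_abs_le[of x] by (simp add: dist_int_def abs_minus_commute)

lemma dist_int_nonneg: "dist_int x \<ge> 0"
  by (simp add: dist_int_def)

lemma dist_int_le: "dist_int x \<le> \<bar>x - of_int k\<bar>"
  unfolding dist_int_def by (rule round_diff_minimal)

lemma dist_int_ge_frac: "dist_int x \<ge> min (frac x) (1 - frac x)"
proof (cases "round x \<le> \<lfloor>x\<rfloor>")
  case True
  then have "of_int (round x) \<le> (of_int \<lfloor>x\<rfloor> :: real)" by simp
  then show ?thesis unfolding dist_int_def frac_def by linarith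
next
  case False
  then have "of_int (round x) \<ge> (of_int (\<lfloor>x\<rfloor> + 1) :: real)" by linarith
  then show ?thesis unfolding dist_int_def frac_def by (simp add: min_def) linarith
qed

lemma sin_pi_mult_ge:
  assumes "0 \<le> t" "t \<le> 1 / 2"
  shows "sin (pi * t) \<ge> t"
proof -
  define y where "y = pi * t"
  have y: "0 \<le> y" "y \<le> 1.6" "t \<le> y / 3"
    using assms pi_approx mult_mono[of pi "3.2" t "1/2"] mult_right_mono[of 3 pi t]
    by (auto simp: y_def)
  have "\<bar>sin y - (\<Sum>m<3. sin_coeff m * y ^ m)\<bar> \<le> inverse (fact 3) * \<bar>y\<bar> ^ 3"
    by (rule Maclaurin_sin_bound)
  moreover have "(\<Sum>m<3. sin_coeff m * y ^ m) = y"
    by (simp add: sin_coeff_def numeral_3_eq_3 lessThan_Suc)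
  ultimately have "\<bar>sin y - y\<bar> \<le> y ^ 3 / 6" using y by (simp add: fact_numeral)
  then have "sin y \<ge> y - y ^ 3 / 6" by linarith
  moreover have "y ^ 3 \<le> y * (1.6)\<^sup>2"
    using mult_left_mono[OF power_mono[OF y(2) y(1), of 2] y(1)] by (simp add: power3_eq_cube power2_eq_square)
  \<comment> \<open>Since 1.6^2 / 6 < 0.43, this leaves sin y \<ge> 0.57 y, which exceeds y / 3
    \<ge> t.\<close>
  then have "y ^ 3 / 6 \<le> y * (43 / 100)" using y(1) by (simp add: power2_eq_square)
  ultimately show ?thesis using y unfolding y_def[symmetric] by linarith
qed

text \<open>The chord has length 2 |sin(\<pi> t)| with t the signed distance to the nearest integer.
  The constant 2 is not sharp; it cancels the 2 that bounds the numerator of a geometric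
  sum.\<close>

lemma norm_e_minus_1_ge: "norm (e x - 1) \<ge> 2 * dist_int x"
proof -
  define t where "t = x - of_int (round x)"
  have "e x = e (t + of_int (round x))" by (simp add: t_def)
  also have "\<dots> = e t" by (simp add: e_add e_of_int)
  also have "\<dots> = exp (\<i> * of_real (2 * pi * t))" by (simp add: e_def mult_ac)
  finally have "norm (e x - 1) = 2 * \<bar>sin (pi * t)\<bar>"
    using dist_exp_i_1[of "2 * pi * t"] by simp
  also have "\<bar>sin (pi * t)\<bar> = \<bar>sin (pi * \<bar>t\<bar>)\<bar>" by (simp add: abs_if)
  also have "\<bar>sin (pi * \<bar>t\<bar>)\<bar> \<ge> \<bar>t\<bar>"
    using sin_pi_mult_ge[of "\<bar>t\<bar>"] dist_int_le_half[of x] by (simp add: t_def dist_int_def)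
  ultimately show ?thesis by (simp add: t_def dist_int_def)
qed

text \<open>This is \<open>min Z (1 / dist_int x)\<close>, with the value \<open>Z\<close> (instead of the junk value 0) at integers.\<close>
definition kern :: "real \<Rightarrow> real \<Rightarrow> real" where
  "kern Z x = (if Z * dist_int x \<le> 1 then Z else 1 / dist_int x)"

lemma kern_nonneg: "Z \<ge> 0 \<Longrightarrow> kern Z x \<ge> 0"
  by (auto simp: kern_def dist_int_nonneg)

lemma kern_le: "Z \<ge> 0 \<Longrightarrow> kern Z x \<le> Z"
  using dist_int_nonneg[of x] by (cases "dist_int x = 0") (auto simp: kern_def field_simps)

lemma kern_le_inverse: "dist_int x > 0 \<Longrightarrow> kern Z x \<le> 1 / dist_int x"
  by (auto simp: kern_def field_simps)

lemma kern_mono: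
  assumes "0 \<le> Z" "Z \<le> Z'"
  shows "kern Z x \<le> kern Z' x"
proof (cases "Z' * dist_int x \<le> 1")
  case True
  moreover have "Z * dist_int x \<le> Z' * dist_int x"
    using assms dist_int_nonneg by (intro mult_right_mono) auto
  ultimately show ?thesis using assms by (simp add: kern_def)
next
  case False
  then have "dist_int x > 0" using dist_int_nonneg[of x] by (cases "dist_int x = 0") auto
  then show ?thesis using kern_le_inverse[of x Z] False by (simp add: kern_def)
qed

text \<open>The trivial bound for x close to an integer, the closed form of the geometric sum
  otherwise. Z only has to dominate the length, so that real quotients N / m can be inserted for
  their floors.\<close>

lemma norm_sum_e_le_kern:
  assumes "real K \<le> Z"
  shows "norm (\<Sum>n=1..K. e (real n * x)) \<le> kern Z x"
proof (cases "Z * dist_int x \<le> 1")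
  case True
  have "norm (\<Sum>n=1..K. e (real n * x)) \<le> (\<Sum>n=1..K. 1)"
    by (intro sum_norm_le) simp
  then show ?thesis using True assms by (simp add: kern_def)
next
  case False
  then have d: "dist_int x > 0" using dist_int_nonneg[of x] by (cases "dist_int x = 0") auto
  then have ne: "e x \<noteq> 1" using norm_e_minus_1_ge[of x] by auto
  have "(\<Sum>n=1..K. e (real n * x)) = (\<Sum>n<K. e x * e x ^ n)"
    unfolding e_of_nat_mult
    by (rule sum.reindex_bij_witness[of _ Suc "\<lambda>n. n - 1"]) (auto simp flip: power_Suc)
  also have "\<dots> = e x * ((e x ^ K - 1) / (e x - 1))"
    using geometric_sum[OF ne] by (simp add: sum_distrib_left[symmetric])
  also have "norm \<dots> = norm (e x ^ K - 1) / norm (e x - 1)"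
    by (simp add: norm_mult norm_divide)
  also have "\<dots> \<le> 2 / (2 * dist_int x)"
    using norm_triangle_ineq4[of "e x ^ K" 1] d norm_e_minus_1_ge[of x]
    by (intro frac_le) (auto simp: norm_power)
  finally show ?thesis using False by (simp add: kern_def)
qed

section \<open>Spacing of \<alpha> m modulo 1 and sums of the kernel\<close>

definition rat_approx :: "real \<Rightarrow> int \<Rightarrow> nat \<Rightarrow> bool" where
  "rat_approx \<alpha> a q \<longleftrightarrow> q \<ge> 1 \<and> coprime a (int q) \<and> \<bar>\<alpha> - of_int a / of_nat q\<bar> \<le> 1 / (of_nat q)\<^sup>2"

text \<open>As q does not divide a h, the fraction a h / q is at distance at least 1 / q from the
  integers; replacing a / q by \<alpha> moves it by at most |h| / q^2 \<le> 1 / (2 q).\<close>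

lemma dist_int_mult_ge:
  assumes "rat_approx \<alpha> a q" and h: "h \<noteq> 0" "2 * \<bar>h\<bar> \<le> int q"
  shows "dist_int (\<alpha> * of_int h) \<ge> 1 / (2 * real q)"
proof -
  have q: "q \<ge> 1" and cop: "coprime a (int q)" and approx: "\<bar>\<alpha> - of_int a / of_nat q\<bar> \<le> 1 / (of_nat q)\<^sup>2"
    using assms(1) by (auto simp: rat_approx_def)
  define k where "k = round (\<alpha> * of_int h)"
  have "\<not> int q dvd a * h"
  proof
    assume "int q dvd a * h"
    then have "int q dvd h" using cop by (simp add: coprime_dvd_mult_right_iff coprime_commute)
    then have "int q \<le> \<bar>h\<bar>" using h by (intro zdvd_imp_le) auto
    then show False using h by linarith
  qed
  then have "a * h - k * int q \<noteq> 0" by (metis dvd_triv_right eq_iff_diff_eq_0)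
  then have "\<bar>a * h - k * int q\<bar> \<ge> 1" by linarith
  then have "1 \<le> real_of_int \<bar>a * h - k * int q\<bar>" by linarith
  then have "1 / real q \<le> \<bar>of_int (a * h - k * int q)\<bar> / real q"
    using q by (intro divide_right_mono) auto
  also have "\<dots> = \<bar>of_int a / real q * of_int h - of_int k\<bar>"
  proof -
    have "of_int a / real q * of_int h - of_int k = of_int (a * h - k * int q) / real q"
      using q by (simp add: field_simps)
    then show ?thesis by (simp only: abs_divide abs_of_nat)
  qed
  finally have 1: "1 / real q \<le> \<bar>of_int a / real q * of_int h - of_int k\<bar>" .
  have "\<bar>(\<alpha> - of_int a / of_nat q) * of_int h\<bar> \<le> 1 / (real q)\<^sup>2 * (real q / 2)"
    unfolding abs_mult using approx h(2) by (intro mult_mono) auto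
  also have "\<dots> = 1 / (2 * real q)" using q by (simp add: power2_eq_square)
  finally have "\<bar>\<alpha> * of_int h - of_int a / real q * of_int h\<bar> \<le> 1 / (2 * real q)"
    by (simp add: algebra_simps)
  moreover have "1 / real q = 2 * (1 / (2 * real q))" by simp
  ultimately show ?thesis using 1 unfolding dist_int_def k_def[symmetric] by linarith
qed

text \<open>Differences of indices in a block of length about \<open>q / 2\<close> are at most \<open>q / 2\<close>, so the points
  \<open>\<alpha> m\<close> are \<open>1 / (2 q)\<close>-separated modulo 1 and fall into different cells of the grid of mesh \<open>1 / (2 q)\<close>.\<close>
lemma inj_on_floor_frac:
  assumes ra: "rat_approx \<alpha> a q" and B: "2 * B \<le> q + 1"
  shows "inj_on (\<lambda>m. nat \<lfloor>2 * real q * frac (\<alpha> * of_int m)\<rfloor>) {m0..<m0 + int B}"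
proof (rule inj_onI, rule ccontr)
  fix m m' assume m: "m \<in> {m0..<m0 + int B}" "m' \<in> {m0..<m0 + int B}" "m \<noteq> m'"
    and "nat \<lfloor>2 * real q * frac (\<alpha> * of_int m)\<rfloor> = nat \<lfloor>2 * real q * frac (\<alpha> * of_int m')\<rfloor>"
  moreover have q: "q \<ge> 1" using ra by (simp add: rat_approx_def)
  ultimately have "\<lfloor>2 * real q * frac (\<alpha> * of_int m)\<rfloor> = \<lfloor>2 * real q * frac (\<alpha> * of_int m')\<rfloor>"
    by (simp add: frac_ge_0 eq_nat_nat_iff)
  then have "\<bar>2 * real q * frac (\<alpha> * of_int m) - 2 * real q * frac (\<alpha> * of_int m')\<bar> < 1"
    by linarith
  then have "2 * real q * \<bar>frac (\<alpha> * of_int m) - frac (\<alpha> * of_int m')\<bar> < 1"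
    by (simp add: abs_mult flip: right_diff_distrib)
  moreover have "dist_int (\<alpha> * of_int (m - m')) \<le> \<bar>frac (\<alpha> * of_int m) - frac (\<alpha> * of_int m')\<bar>"
    using dist_int_le[of "\<alpha> * of_int (m - m')" "\<lfloor>\<alpha> * of_int m\<rfloor> - \<lfloor>\<alpha> * of_int m'\<rfloor>"]
    by (simp add: frac_def algebra_simps)
  moreover have "dist_int (\<alpha> * of_int (m - m')) \<ge> 1 / (2 * real q)"
  proof (rule dist_int_mult_ge[OF ra])
    show "m - m' \<noteq> 0" using m by simp
    show "2 * \<bar>m - m'\<bar> \<le> int q" using m(1,2) B by (simp add: abs_if)
  qed
  ultimately show False using q by (simp add: field_simps) (smt (verit) mult_left_mono of_nat_0_le_iff)
qed

text \<open>Here k is the index of the cell of mesh 1 / (2 q) containing the fractional part of x.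
  It gives the distance k / (2 q) from the integer below, and the mirrored index 2 q - 1 - k that
  from the integer above. In an outermost cell the quotient with denominator 0 has value 0, and the
  \<open>of_bool\<close> term supplies the trivial bound Z.\<close>

lemma kern_le_of_floor_frac:
  fixes q k :: nat
  assumes Z: "Z \<ge> 0" and q: "q \<ge> 1" and k: "k = nat \<lfloor>2 * real q * frac x\<rfloor>"
  shows "k < 2 * q" and
    "kern Z x \<le> of_bool (k = 0) * Z + 2 * real q / real k
      + (of_bool (2 * q - Suc k = 0) * Z + 2 * real q / real (2 * q - Suc k))"
proof -
  have k': "real k \<le> 2 * real q * frac x" "2 * real q * frac x < real k + 1"
    unfolding k using q by (auto simp: frac_ge_0)
  have "2 * real q * frac x < 2 * real q * 1"
    using q frac_lt_1[of x] by (intro mult_strict_left_mono) auto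
  then have "real k < real (2 * q)" using k' by simp
  then show k2: "k < 2 * q" by linarith
  show "kern Z x \<le> of_bool (k = 0) * Z + 2 * real q / real k
      + (of_bool (2 * q - Suc k = 0) * Z + 2 * real q / real (2 * q - Suc k))"
  proof (cases "k = 0 \<or> 2 * q - Suc k = 0")
    case True
    have "Z \<le> of_bool (k = 0) * Z + of_bool (2 * q - Suc k = 0) * Z" using True Z by auto
    also have "\<dots> \<le> of_bool (k = 0) * Z + 2 * real q / real k
      + (of_bool (2 * q - Suc k = 0) * Z + 2 * real q / real (2 * q - Suc k))"
      by (intro add_mono) simp_all
    finally show ?thesis using kern_le[OF Z, of x] by (rule order.trans[rotated])
  next
    case False
    then have pos: "real k > 0" "real (2 * q - Suc k) > 0" by auto
    have 1: "frac x \<ge> real k / (2 * real q)" using k'(1) q by (simp add: field_simps)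
    have "1 - frac x \<ge> real (2 * q - Suc k) / (2 * real q)"
      using k'(2) q k2 by (simp add: field_simps of_nat_diff)
    with 1 dist_int_ge_frac[of x]
    have "dist_int x \<ge> real k / (2 * real q) \<or> dist_int x \<ge> real (2 * q - Suc k) / (2 * real q)"
      by linarith
    moreover have "kern Z x \<le> 2 * real q / r" if "r > 0" "dist_int x \<ge> r / (2 * real q)" for r
    proof -
      have p: "r / (2 * real q) > 0" using that q by simp
      then have "kern Z x \<le> 1 / dist_int x" using that by (intro kern_le_inverse) linarith
      also have "\<dots> \<le> 1 / (r / (2 * real q))" using p that by (intro divide_left_mono mult_pos_pos) linarith+
      finally show ?thesis by simp
    qed
    ultimately have "kern Z x \<le> 2 * real q / real k \<or> kern Z x \<le> 2 * real q / real (2 * q - Suc k)"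
      using pos by blast
    then have "kern Z x \<le> 2 * real q / real k + 2 * real q / real (2 * q - Suc k)"
      by (auto intro: add_increasing add_increasing2)
    then show ?thesis using False by simp
  qed
qed

lemma sum_kern_block_le:
  assumes ra: "rat_approx \<alpha> a q" and B: "2 * B \<le> q + 1" and Z: "Z \<ge> 0"
  shows "(\<Sum>m\<in>{m0..<m0 + int B}. kern Z (\<alpha> * of_int m)) \<le> 2 * Z + 4 * real q * (1 + ln (2 * real q))"
proof -
  have q: "q \<ge> 1" using ra by (simp add: rat_approx_def)
  define f where "f m = nat \<lfloor>2 * real q * frac (\<alpha> * of_int m)\<rfloor>" for m :: int
  define g where "g k = of_bool (k = 0) * Z + 2 * real q / real k" for k :: nat
  have g_nonneg: "g k \<ge> 0" for k using Z by (simp add: g_def)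
  have "(\<Sum>m\<in>{m0..<m0 + int B}. kern Z (\<alpha> * of_int m))
        \<le> (\<Sum>m\<in>{m0..<m0 + int B}. g (f m) + g (2 * q - Suc (f m)))"
    unfolding g_def by (intro sum_mono kern_le_of_floor_frac(2) Z q) (simp add: f_def)
  also have "\<dots> = (\<Sum>k\<in>f ` {m0..<m0 + int B}. g k + g (2 * q - Suc k))"
    using inj_on_floor_frac[OF ra B, of m0] by (subst sum.reindex) (simp_all add: f_def [abs_def])
  also have "\<dots> \<le> (\<Sum>k<2 * q. g k + g (2 * q - Suc k))"
    using kern_le_of_floor_frac(1)[OF Z q] g_nonneg by (intro sum_mono2) (auto simp: f_def)
  \<comment> \<open>The reflection of k to 2 q - 1 - k permutes the cells.\<close>
  also have "\<dots> = 2 * (\<Sum>k<2 * q. g k)"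
    by (simp add: sum.distrib sum.nat_diff_reindex)
  also have "(\<Sum>k<2 * q. g k) = Z + (\<Sum>k<2 * q. 2 * real q / real k)"
    using q unfolding g_def by (simp add: sum.distrib flip: sum_distrib_right) 
  also have "(\<Sum>k<2 * q. 2 * real q / real k) \<le> 2 * real q * (1 + ln (2 * real q))"
  proof -
    have "(\<Sum>k<2 * q. 2 * real q / real k) = (\<Sum>k\<in>{1..<2*q}. 2 * real q / real k)"
      by (rule sum.mono_neutral_right) auto
    also have "\<dots> \<le> (\<Sum>k=1..2*q. 2 * real q * (1 / real k))" by (subst times_divide_eq_right, simp, intro sum_mono2) auto
    also have "\<dots> = 2 * real q * (\<Sum>k=1..2*q. 1 / real k)" by (simp add: sum_distrib_left)
    also have "\<dots> \<le> 2 * real q * (1 + ln (real (2 * q)))"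
      using q by (intro mult_left_mono sum_inverse_le_ln) auto
    finally show ?thesis by simp
  qed
  finally show ?thesis by (simp add: algebra_simps)
qed

lemma sum_kern_interval_le:
  assumes ra: "rat_approx \<alpha> a q" and Z: "Z \<ge> 0"
  shows "(\<Sum>m\<in>{m0..<m0 + int M}. kern Z (\<alpha> * of_int m))
    \<le> (2 * real M / real q + 1) * (2 * Z + 4 * real q * (1 + ln (2 * real q)))"
proof -
  \<comment> \<open>Half of q rounded up: positive even for q = 1, differences inside a block stay
    at most q / 2, and at most 2 M / q + 1 blocks cover M indices.\<close>
  define B where "B = (q + 1) div 2"
  define W where "W = 2 * Z + 4 * real q * (1 + ln (2 * real q))"
  have q: "q \<ge> 1" using ra by (simp add: rat_approx_def)
  have B: "2 * B \<le> q + 1" "q \<le> 2 * B" "B \<ge> 1" using q unfolding B_def by linarith+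
  have W: "W \<ge> 0" using Z q by (simp add: W_def)
  have "(\<Sum>m\<in>{m0..<m0 + int (t * B)}. kern Z (\<alpha> * of_int m)) \<le> real t * W" for t
  proof (induction t)
    case (Suc t)
    have "int (Suc t * B) = int (t * B) + int B" by simp
    then have "{m0..<m0 + int (Suc t * B)}
        = {m0..<m0 + int (t * B)} \<union> {m0 + int (t * B)..<m0 + int (t * B) + int B}"
      by (auto simp del: of_nat_mult)
    then have "(\<Sum>m\<in>{m0..<m0 + int (Suc t * B)}. kern Z (\<alpha> * of_int m))
        = (\<Sum>m\<in>{m0..<m0 + int (t * B)}. kern Z (\<alpha> * of_int m))
         + (\<Sum>m\<in>{m0 + int (t * B)..<m0 + int (t * B) + int B}. kern Z (\<alpha> * of_int m))"
      by (simp only:) (rule sum.union_disjoint, auto simp del: of_nat_mult)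
    also have "\<dots> \<le> real t * W + W"
      using sum_kern_block_le[OF ra B(1) Z] unfolding W_def[symmetric] by (intro add_mono Suc.IH)
    finally show ?case by (simp add: algebra_simps)
  qed simp
  note 1 = this[of "M div B + 1"]
  have "M \<le> (M div B + 1) * B" using B dividend_less_div_times[of B M] by simp
  then have "(\<Sum>m\<in>{m0..<m0 + int M}. kern Z (\<alpha> * of_int m)) \<le> (\<Sum>m\<in>{m0..<m0 + int ((M div B + 1) * B)}. kern Z (\<alpha> * of_int m))"
    using Z by (intro sum_mono2) (auto intro: kern_nonneg simp del: of_nat_mult of_nat_add mult_Suc simp flip: of_nat_mult)
  also note 1
  also have "real (M div B + 1) * W \<le> (2 * real M / real q + 1) * W"
  proof (intro mult_right_mono W)
    have "real (M div B) \<le> real M / real B" using B by (intro real_div_bounds) auto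
    also have "\<dots> \<le> real M / (real q / 2)" using B q by (intro divide_left_mono) auto
    finally show "real (M div B + 1) \<le> 2 * real M / real q + 1" by (simp add: mult_ac)
  qed
  finally show ?thesis by (simp add: W_def)
qed

lemma ln_double_le:
  assumes "1 \<le> q" "q \<le> N"
  shows "1 + ln (2 * real q) \<le> 2 * (1 + ln (real N))"
proof -
  have "ln (2 * real q) = ln 2 + ln (real q)" using assms by (simp add: ln_mult)
  moreover have "ln (real q) \<le> ln (real N)" "ln (real q) \<ge> 0" using assms by auto
  moreover have "ln 2 \<le> (1::real)" using ln_le_minus_one[of 2] by simp
  ultimately show ?thesis by (smt (verit))
qed

text \<open>The height N / m varies with m, so in the block starting at j B it is replaced by N / (j
  B), and these heights sum to a harmonic series. The block j = 0 has no such height; there 0 < m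
  \<le> q / 2 keeps \<alpha> m away from the integers, and height 2 q suffices.\<close>

lemma sum_kern_hyperbola_le:
  assumes ra: "rat_approx \<alpha> a q" and q: "q \<le> N" and Y: "Y \<le> N"
  shows "(\<Sum>m=1..Y. kern (real N / real m) (\<alpha> * real m))
    \<le> 16 * (1 + ln (real N)) * (real N / real q + real Y + real q)"
proof -
  define B where "B = (q + 1) div 2"
  define J where "J = Y div B"
  define l where "l = 1 + ln (real N)"
  have q1: "q \<ge> 1" using ra by (simp add: rat_approx_def)
  have B: "2 * B \<le> q + 1" "q \<le> 2 * B" "B \<ge> 1" using q1 unfolding B_def by linarith+
  have l: "l \<ge> 1" using q q1 by (simp add: l_def)
  have lq: "1 + ln (2 * real q) \<le> 2 * l" unfolding l_def by (rule ln_double_le[OF q1 q])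
  \<comment> \<open>Setting the value 0 at m = 0 allows padding the range to whole blocks that start
    at 0.\<close>
  define F where "F m = (if m = 0 then 0 else kern (real N / real m) (\<alpha> * real m))" for m
  have F_nonneg: "F m \<ge> 0" for m by (simp add: F_def kern_nonneg)
  have block: "(\<Sum>m\<in>{j*B..<j*B+B}. kern Z (\<alpha> * real m)) \<le> 2 * Z + 8 * real q * l" if "Z \<ge> 0" for Z j
  proof -
    define c where "c = j * B"
    have "(\<Sum>m\<in>{c..<c+B}. kern Z (\<alpha> * real m)) = (\<Sum>m\<in>{int c..<int c + int B}. kern Z (\<alpha> * of_int m))"
      by (rule sum.reindex_bij_witness[of _ nat int]) auto
    also have "\<dots> \<le> 2 * Z + 4 * real q * (1 + ln (2 * real q))"
      by (rule sum_kern_block_le[OF ra B(1) that])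
    also have "\<dots> \<le> 2 * Z + 4 * real q * (2 * l)"
      using lq by (intro add_left_mono mult_left_mono) auto
    finally show ?thesis by (simp add: c_def)
  qed
  have "Y < Suc J * B" unfolding J_def using B dividend_less_div_times[of B Y] by simp
  then have "(\<Sum>m=1..Y. kern (real N / real m) (\<alpha> * real m)) \<le> (\<Sum>m<Suc J * B. F m)"
    using F_nonneg by (intro sum_le_included[where i = id]) (auto simp: F_def intro!: bexI)
  also have "\<dots> = (\<Sum>j<Suc J. \<Sum>m\<in>{j*B..<j*B+B}. F m)"
    by (rule sum.nat_group[symmetric])
  also have "\<dots> = (\<Sum>m\<in>{0*B..<0*B+B}. F m) + (\<Sum>j=1..J. \<Sum>m\<in>{j*B..<j*B+B}. F m)"
    by (subst sum.lessThan_Suc_shift) (rule arg_cong2[where f = "(+)", OF refl], rule sum.reindex_bij_witness[of _ "\<lambda>j. j - 1" Suc], auto)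
  also have "(\<Sum>m\<in>{0*B..<0*B+B}. F m) \<le> (\<Sum>m\<in>{0*B..<0*B+B}. kern (2 * real q) (\<alpha> * real m))"
  proof (rule sum_mono)
    fix m assume m: "m \<in> {0*B..<0*B+B}"
    show "F m \<le> kern (2 * real q) (\<alpha> * real m)"
    proof (cases "m = 0")
      case False
      have d: "dist_int (\<alpha> * real m) \<ge> 1 / (2 * real q)"
        using dist_int_mult_ge[OF ra, of "int m"] m False B by simp
      moreover have "1 / (2 * real q) > 0" using q1 by simp
      ultimately have p: "dist_int (\<alpha> * real m) > 0" by linarith
      have "F m \<le> 1 / dist_int (\<alpha> * real m)" using False kern_le_inverse[OF p] by (simp add: F_def)
      \<comment> \<open>At distance at least 1 / (2 q) the kernel of height 2 q is not
        capped.\<close>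
      also have "1 / dist_int (\<alpha> * real m) \<le> kern (2 * real q) (\<alpha> * real m)"
        using d q1 p by (auto simp: kern_def field_simps)
      finally show ?thesis .
    qed (auto simp: F_def kern_nonneg)
  qed
  also have "\<dots> \<le> 2 * (2 * real q) + 8 * real q * l" by (rule block) auto
  also have "(\<Sum>j=1..J. \<Sum>m\<in>{j*B..<j*B+B}. F m) \<le> (\<Sum>j=1..J. 2 * (real N / real (j*B)) + 8 * real q * l)"
  proof (rule sum_mono)
    fix j assume j: "j \<in> {1..J}"
    have "(\<Sum>m\<in>{j*B..<j*B+B}. F m) \<le> (\<Sum>m\<in>{j*B..<j*B+B}. kern (real N / real (j*B)) (\<alpha> * real m))"
    proof (rule sum_mono)
      fix m assume m: "m \<in> {j*B..<j*B+B}"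
      have jB: "j * B > 0" using j B by auto
      have "j * B \<le> m" using m by simp
      with jB have "m > 0" "real (j * B) \<le> real m" by linarith+
      then have "real N / real m \<le> real N / real (j * B)"
        using jB by (intro divide_left_mono mult_pos_pos) (simp_all only: of_nat_0_less_iff of_nat_0_le_iff)
      then show "F m \<le> kern (real N / real (j*B)) (\<alpha> * real m)"
        using \<open>m > 0\<close> by (auto simp: F_def intro: kern_mono)
    qed
    also have "\<dots> \<le> 2 * (real N / real (j*B)) + 8 * real q * l" by (rule block) auto
    finally show "(\<Sum>m\<in>{j*B..<j*B+B}. F m) \<le> 2 * (real N / real (j*B)) + 8 * real q * l" .
  qed
  also have "(\<Sum>j=1..J. 2 * (real N / real (j*B)) + 8 * real q * l)
      = 2 * real N / real B * (\<Sum>j=1..J. 1 / real j) + real J * (8 * real q * l)"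
    by (simp add: sum.distrib sum_distrib_left mult_ac)
  also have "\<dots> \<le> 4 * real N / real q * l + 2 * real Y / real q * (8 * real q * l)"
  proof (intro add_mono mult_mono)
    have "2 * real N / real B \<le> 2 * real N / (real q / 2)"
      using B q1 by (intro divide_left_mono) auto
    then show "2 * real N / real B \<le> 4 * real N / real q" by simp
    show "(\<Sum>j=1..J. 1 / real j) \<le> l"
    proof (cases "J = 0")
      case False
      then have "(\<Sum>j=1..J. 1 / real j) \<le> 1 + ln (real J)" by (intro sum_inverse_le_ln) auto
      also have "J \<le> Y" by (simp add: J_def)
      then have "ln (real J) \<le> ln (real N)" using False Y by auto
      finally show ?thesis by (simp add: l_def)
    qed (use l in auto)
    have "real J \<le> real Y / real B" unfolding J_def using B by (intro real_div_bounds) auto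
    also have "\<dots> \<le> real Y / (real q / 2)" using B q1 by (intro divide_left_mono) auto
    finally show "real J \<le> 2 * real Y / real q" by (simp add: mult_ac)
  qed (use l in \<open>auto intro: sum_nonneg\<close>)
  finally have "(\<Sum>m=1..Y. kern (real N / real m) (\<alpha> * real m))
    \<le> 2 * (2 * real q) + 8 * real q * l + (4 * real N / real q * l + 2 * real Y / real q * (8 * real q * l))"
    by simp
  also have "\<dots> = 4 * real q * 1 + 8 * real q * l + 4 * l * (real N / real q) + 16 * l * real Y"
    using q1 by (simp add: field_simps)
  also have "\<dots> \<le> 4 * real q * l + 12 * real q * l + 16 * l * (real N / real q) + 16 * l * real Y"
  proof -
    have "4 * real q * 1 \<le> 4 * real q * l" using l by (intro mult_left_mono) auto
    moreover have "8 * real q * l \<le> 12 * real q * l" "4 * l * (real N / real q) \<le> 16 * l * (real N / real q)"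
      using l by (intro mult_right_mono; simp)+
    ultimately show ?thesis by linarith
  qed
  also have "\<dots> = 16 * l * (real N / real q + real Y + real q)" by (simp add: algebra_simps)
  finally show ?thesis by (simp add: l_def)
qed

section \<open>Bilinear exponential sums over a dyadic block\<close>

text \<open>The coefficients b stay outside in the Cauchy--Schwarz inequality and enter only through
  their mean square. Opening the other square gives pairs m1, m2 with a geometric sum over n up to N
  / max(m1, m2), to which the bounded coefficients h contribute a factor at most 1.\<close>

lemma bilinear_sum_squared_le:
  fixes h b :: "nat \<Rightarrow> real"
  assumes ra: "rat_approx \<alpha> a q" and M: "M \<ge> 1" and h: "\<And>m. m \<in> {M..<2*M} \<Longrightarrow> \<bar>h m\<bar> \<le> 1"
  shows "(norm (\<Sum>m\<in>{M..<2*M}. \<Sum>n=1..N div m. of_real (h m * b n) * e (real (m * n) * \<alpha>)))\<^sup>2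
    \<le> (\<Sum>n=1..N div M. (b n)\<^sup>2) *
       (real M * ((2 * real M / real q + 1) * (2 * (real N / real M) + 4 * real q * (1 + ln (2 * real q)))))"
proof -
  \<comment> \<open>The indicator of m n \<le> N gives all m of the block the common range n \<le>
    \<open>N div M\<close>, so that the order of summation can be exchanged.\<close>
  define T where "T n = (\<Sum>m\<in>{M..<2*M}. of_bool (m * n \<le> N) * of_real (h m) * e (real (m * n) * \<alpha>))" for n
  have "(\<Sum>m\<in>{M..<2*M}. \<Sum>n=1..N div m. of_real (h m * b n) * e (real (m * n) * \<alpha>))
      = (\<Sum>m\<in>{M..<2*M}. \<Sum>n=1..N div M. of_real (b n) * (of_bool (m * n \<le> N) * of_real (h m) * e (real (m * n) * \<alpha>)))"
  proof (rule sum.cong[OF refl], rule sum.mono_neutral_cong_left)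
    fix m assume m: "m \<in> {M..<2*M}"
    then show "{1..N div m} \<subseteq> {1..N div M}"
      using M div_le_mono2[of M m N] by auto
    show "\<forall>n\<in>{1..N div M} - {1..N div m}. of_real (b n) * (of_bool (m * n \<le> N) * of_real (h m) * e (real (m * n) * \<alpha>)) = 0"
      using m M by (auto simp: less_eq_div_iff_mult_less_eq mult.commute)
    fix n assume "n \<in> {1..N div m}"
    then have "m * n \<le> N" using m M by (auto simp: less_eq_div_iff_mult_less_eq mult.commute)
    then show "of_real (h m * b n) * e (real (m * n) * \<alpha>) = of_real (b n) * (of_bool (m * n \<le> N) * of_real (h m) * e (real (m * n) * \<alpha>))"
      by simp
  qed auto
  also have "\<dots> = (\<Sum>n=1..N div M. of_real (b n) * T n)"
    unfolding T_def by (subst sum.swap) (simp only: sum_distrib_left)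
  finally have eq: "(\<Sum>m\<in>{M..<2*M}. \<Sum>n=1..N div m. of_real (h m * b n) * e (real (m * n) * \<alpha>))
    = (\<Sum>n=1..N div M. of_real (b n) * T n)" .
  have "norm (\<Sum>n=1..N div M. of_real (b n) * T n) \<le> (\<Sum>n=1..N div M. \<bar>b n\<bar> * norm (T n))"
    by (intro sum_norm_le) (simp add: norm_mult)
  then have "(norm (\<Sum>n=1..N div M. of_real (b n) * T n))\<^sup>2 \<le> (\<Sum>n=1..N div M. \<bar>b n\<bar> * norm (T n))\<^sup>2"
    by (intro power_mono) auto
  also have "\<dots> \<le> (\<Sum>n=1..N div M. \<bar>b n\<bar>\<^sup>2) * (\<Sum>n=1..N div M. (norm (T n))\<^sup>2)"
    by (rule Cauchy_Schwarz_ineq_sum)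
  also have "(\<Sum>n=1..N div M. \<bar>b n\<bar>\<^sup>2) = (\<Sum>n=1..N div M. (b n)\<^sup>2)" by simp
  also have "(\<Sum>n=1..N div M. (b n)\<^sup>2) * (\<Sum>n=1..N div M. (norm (T n))\<^sup>2) \<le> (\<Sum>n=1..N div M. (b n)\<^sup>2) * 
     (real M * ((2 * real M / real q + 1) * (2 * (real N / real M) + 4 * real q * (1 + ln (2 * real q)))))"
  proof (intro mult_left_mono sum_nonneg)
    define E where "E m1 m2 = (\<Sum>n=1..N div max m1 m2. e (real n * (\<alpha> * (real m1 - real m2))))" for m1 m2
    have "of_real (\<Sum>n=1..N div M. (norm (T n))\<^sup>2) = (\<Sum>n=1..N div M. T n * cnj (T n))"
      by (simp add: complex_norm_square del: of_real_power)
    also have "\<dots> = (\<Sum>n=1..N div M. \<Sum>m1\<in>{M..<2*M}. \<Sum>m2\<in>{M..<2*M}. of_real (h m1 * h m2) *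
        (of_bool (m1 * n \<le> N \<and> m2 * n \<le> N) * e (real n * (\<alpha> * (real m1 - real m2)))))"
      unfolding T_def cnj_sum sum_product
    proof (intro sum.cong refl, goal_cases)
      case (1 n m1 m2)
      have eq: "e (real (m1 * n) * \<alpha>) * e (- (real (m2 * n) * \<alpha>)) = e (real n * (\<alpha> * (real m1 - real m2)))"
        unfolding e_add[symmetric] by (simp add: algebra_simps)
      have "cnj (of_bool (m2 * n \<le> N) * of_real (h m2) * e (real (m2 * n) * \<alpha>))
          = of_bool (m2 * n \<le> N) * of_real (h m2) * e (- (real (m2 * n) * \<alpha>))"
        by (simp add: cnj_e)
      moreover have "of_bool P * of_real x * u * (of_bool Q * of_real y * v) = of_real (x * y) * (of_bool (P \<and> Q) * w)"
        if "u * v = w" for P Q x y and u v w :: complex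
        using that by auto
      ultimately show ?case using eq by presburger
    qed
    also have "\<dots> = (\<Sum>m1\<in>{M..<2*M}. \<Sum>m2\<in>{M..<2*M}. \<Sum>n=1..N div M. of_real (h m1 * h m2) *
        (of_bool (m1 * n \<le> N \<and> m2 * n \<le> N) * e (real n * (\<alpha> * (real m1 - real m2)))))"
      by (subst sum.swap) (intro sum.cong refl sum.swap)
    also have "\<dots> = (\<Sum>m1\<in>{M..<2*M}. \<Sum>m2\<in>{M..<2*M}. of_real (h m1 * h m2) * E m1 m2)"
      unfolding sum_distrib_left[symmetric]
    proof (intro sum.cong refl arg_cong2[where f = "(*)"])
      fix m1 m2 assume m: "m1 \<in> {M..<2*M}" "m2 \<in> {M..<2*M}"
      have "(m1 * n \<le> N \<and> m2 * n \<le> N) \<longleftrightarrow> n \<le> N div max m1 m2" for n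
      proof -
        have "max m1 m2 * n \<le> N \<longleftrightarrow> m1 * n \<le> N \<and> m2 * n \<le> N" by (simp add: nat_mult_max_left)
        then show ?thesis using m M by (simp add: less_eq_div_iff_mult_less_eq mult.commute max_def)
      qed
      moreover have "N div max m1 m2 \<le> N div M" using m M by (intro div_le_mono2) auto
      ultimately show "(\<Sum>n=1..N div M. of_bool (m1 * n \<le> N \<and> m2 * n \<le> N) * e (real n * (\<alpha> * (real m1 - real m2)))) = E m1 m2"
        unfolding E_def by (intro sum.mono_neutral_cong_right) auto
    qed
    finally have expand: "of_real (\<Sum>n=1..N div M. (norm (T n))\<^sup>2)
        = (\<Sum>m1\<in>{M..<2*M}. \<Sum>m2\<in>{M..<2*M}. of_real (h m1 * h m2) * E m1 m2)" .
    have "(\<Sum>n=1..N div M. (norm (T n))\<^sup>2) = norm (of_real (\<Sum>n=1..N div M. (norm (T n))\<^sup>2) :: complex)"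
      unfolding norm_of_real by (rule abs_of_nonneg[symmetric]) (simp add: sum_nonneg)
    also have "\<dots> = norm (\<Sum>m1\<in>{M..<2*M}. \<Sum>m2\<in>{M..<2*M}. of_real (h m1 * h m2) * E m1 m2)"
      by (simp only: expand)
    also have "\<dots> \<le> (\<Sum>m1\<in>{M..<2*M}. \<Sum>m2\<in>{M..<2*M}. kern (real N / real M) (\<alpha> * (real m1 - real m2)))"
    proof (intro sum_norm_le)
      fix m1 m2 assume m: "m1 \<in> {M..<2*M}" "m2 \<in> {M..<2*M}"
      have "norm (E m1 m2) \<le> kern (real N / real M) (\<alpha> * (real m1 - real m2))"
        unfolding E_def
      proof (rule norm_sum_e_le_kern)
        have "N div max m1 m2 \<le> N div M" using m M by (intro div_le_mono2) auto
        then have "real (N div max m1 m2) \<le> real (N div M)" by simp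
        also have "\<dots> \<le> real N / real M" using M by (intro real_div_bounds) auto
        finally show "real (N div max m1 m2) \<le> real N / real M" .
      qed
      moreover have "norm (of_real (h m1 * h m2) :: complex) \<le> 1"
        using h m by (simp add: norm_mult abs_mult mult_le_one)
      ultimately show "norm (of_real (h m1 * h m2) * E m1 m2) \<le> kern (real N / real M) (\<alpha> * (real m1 - real m2))"
        using mult_mono[of "norm (of_real (h m1 * h m2) :: complex)" 1 "norm (E m1 m2)" "kern (real N / real M) (\<alpha> * (real m1 - real m2))"]
        by (simp only: norm_mult) simp
    qed
    also have "\<dots> = (\<Sum>m2\<in>{M..<2*M}. \<Sum>m1\<in>{M..<2*M}. kern (real N / real M) (\<alpha> * (real m1 - real m2)))"
      by (rule sum.swap)
    also have "\<dots> \<le> (\<Sum>m2\<in>{M..<2*M}. ((2 * real M / real q + 1) * (2 * (real N / real M) + 4 * real q * (1 + ln (2 * real q)))))"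
    proof (intro sum_mono)
      fix m2 assume "m2 \<in> {M..<2*M}"
      \<comment> \<open>For fixed m2 the differences m1 - m2 are M consecutive integers, possibly
        negative, whence the integer index in the interval bound.\<close>
      have "(\<Sum>m1\<in>{M..<2*M}. kern (real N / real M) (\<alpha> * (real m1 - real m2)))
        = (\<Sum>m\<in>{int M - int m2..<int M - int m2 + int M}. kern (real N / real M) (\<alpha> * of_int m))"
        by (rule sum.reindex_bij_witness[of _ "\<lambda>m. nat (m + int m2)" "\<lambda>m. int m - int m2"]) auto
      also have "\<dots> \<le> (2 * real M / real q + 1) * (2 * (real N / real M) + 4 * real q * (1 + ln (2 * real q)))"
        by (rule sum_kern_interval_le[OF ra]) auto
      finally show "(\<Sum>m1\<in>{M..<2*M}. kern (real N / real M) (\<alpha> * (real m1 - real m2)))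
        \<le> (2 * real M / real q + 1) * (2 * (real N / real M) + 4 * real q * (1 + ln (2 * real q)))" .
    qed
    finally show "(\<Sum>n=1..N div M. (norm (T n))\<^sup>2) \<le> real M * ((2 * real M / real q + 1) * (2 * (real N / real M) + 4 * real q * (1 + ln (2 * real q))))"
      by simp
  qed auto
  finally show ?thesis unfolding eq .
qed

section \<open>Vaughan decomposition\<close>

lemma mobius_trunc_eq_of_le:
  assumes "k > 0" "k \<le> K"
  shows "mobius_trunc K k = of_bool (k = 1)"
proof -
  have "{d. d dvd k \<and> d \<le> K} = {d. d dvd k}"
    using assms by (auto intro: order.trans[OF dvd_imp_le])
  then show ?thesis using sum_mobius_mu[OF assms(1)] by (simp add: mobius_trunc_def)
qed

text \<open>With \<open>F\<close>, \<open>G\<close> the Dirichlet polynomials of \<open>mu_hat\<close>, \<open>mobius_mu\<close> truncated at \<open>K\<close>, \<open>H\<close> the Dirichlet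
  series of \<open>mu_hat\<close> and \<open>S\<close> that of the squarefull indicator, this is the coefficientwise form of
  \<open>H = F + G S - F G \<zeta> + (H - F) (1 - \<zeta> G)\<close>, which holds because \<open>\<zeta> H = S\<close>.\<close>
lemma vaughan_identity_mu_hat:
  assumes n: "n > 0" and K: "K \<ge> 1"
  shows "mu_hat n = of_bool (n \<le> K) * mu_hat n
    + (\<Sum>d | d dvd n. of_bool (d \<le> K \<and> squarefull (n div d)) * mobius_mu d)
    - (\<Sum>m | m dvd n. of_bool (m \<le> K) * mu_hat m * mobius_trunc K (n div m))
    - (\<Sum>m | m dvd n. of_bool (m > K \<and> n div m > K) * mu_hat m * mobius_trunc K (n div m))"
proof -
  let ?b = "mobius_trunc K"
  have "(\<Sum>m | m dvd n. mu_hat m * ?b (n div m))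
      = (\<Sum>m | m dvd n. \<Sum>d | d dvd n div m. of_bool (d \<le> K) * mu_hat m * mobius_mu d)"
  proof (intro sum.cong refl)
    fix m assume "m \<in> {m. m dvd n}"
    then have "n div m > 0" using n by (auto simp: dvd_div_eq_0_iff intro: Nat.gr0I)
    then have "?b (n div m) = (\<Sum>d | d dvd n div m. of_bool (d \<le> K) * mobius_mu d)"
      unfolding mobius_trunc_def by (intro sum.mono_neutral_cong_left) auto
    then show "mu_hat m * ?b (n div m) = (\<Sum>d | d dvd n div m. of_bool (d \<le> K) * mu_hat m * mobius_mu d)"
      by (simp add: sum_distrib_left mult_ac)
  qed
  also have "\<dots> = (\<Sum>d | d dvd n. \<Sum>m | m dvd n div d. of_bool (d \<le> K) * mu_hat m * mobius_mu d)"
    by (rule sum_divisors_complement_swap[OF n])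
  also have "\<dots> = (\<Sum>d | d dvd n. of_bool (d \<le> K) * (\<Sum>m | m dvd n div d. mu_hat m) * mobius_mu d)"
    by (simp add: sum_distrib_left sum_distrib_right)
  also have "\<dots> = (\<Sum>d | d dvd n. of_bool (d \<le> K \<and> squarefull (n div d)) * mobius_mu d)"
    using n by (intro sum.cong refl, subst sum_mu_hat_divisors)
      (auto simp: dvd_div_eq_0_iff intro: Nat.gr0I)
  finally have 1: "(\<Sum>m | m dvd n. mu_hat m * ?b (n div m))
      = (\<Sum>d | d dvd n. of_bool (d \<le> K \<and> squarefull (n div d)) * mobius_mu d)" .
  \<comment> \<open>A divisor m has m \<le> K, or both m and n / m exceed K, or m > K and n / m
    \<le> K. In the last range the truncated sum is the indicator of n / m = 1, which leaves only m
    = n.\<close>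
  have "(\<Sum>m | m dvd n. mu_hat m * ?b (n div m))
      = (\<Sum>m | m dvd n. of_bool (m \<le> K) * mu_hat m * ?b (n div m)
          + (of_bool (m > K \<and> n div m > K) * mu_hat m * ?b (n div m)
          + (if m = n then of_bool (n > K) * mu_hat n else 0)))"
  proof (intro sum.cong refl)
    fix m assume "m \<in> {m. m dvd n}"
    then have m: "m dvd n" "n div m > 0" using n by (auto simp: dvd_div_eq_0_iff intro: Nat.gr0I)
    have "n div m = 1 \<longleftrightarrow> m = n" using m n by (auto elim!: dvdE)
    then show "mu_hat m * ?b (n div m) = of_bool (m \<le> K) * mu_hat m * ?b (n div m)
          + (of_bool (m > K \<and> n div m > K) * mu_hat m * ?b (n div m)
          + (if m = n then of_bool (n > K) * mu_hat n else 0))"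
      using mobius_trunc_eq_of_le[OF m(2), of K] K
      by (cases "m \<le> K"; cases "n div m \<le> K") auto
  qed
  also have "\<dots> = (\<Sum>m | m dvd n. of_bool (m \<le> K) * mu_hat m * ?b (n div m))
      + ((\<Sum>m | m dvd n. of_bool (m > K \<and> n div m > K) * mu_hat m * ?b (n div m)) + of_bool (n > K) * mu_hat n)"
    using n by (simp add: sum.distrib)
  finally show ?thesis using 1 by (cases "n \<le> K") (simp_all add: not_le)
qed

section \<open>Bounds for the squarefull, type I and type II sums\<close>

text \<open>Enlarging k \<le> N / d to k \<le> N makes the count of pairs factor into at most K
  times the number of squarefull integers up to N.\<close>

lemma squarefull_sum_le:
  assumes N: "N \<ge> 1"
  shows "norm (\<Sum>d=1..N. \<Sum>k=1..N div d. of_int (of_bool (d \<le> K \<and> squarefull k) * mobius_mu d) * e (real (d * k) * \<alpha>))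
    \<le> real K * (sqrt (real N) * (1 + ln (real N)))"
proof -
  have "norm (\<Sum>d=1..N. \<Sum>k=1..N div d. of_int (of_bool (d \<le> K \<and> squarefull k) * mobius_mu d) * e (real (d * k) * \<alpha>))
     \<le> (\<Sum>d=1..N. \<Sum>k=1..N. of_bool (d \<le> K) * of_bool (squarefull k))"
  proof (intro sum_norm_le)
    fix d assume d: "d \<in> {1..N}"
    have "norm (\<Sum>k=1..N div d. of_int (of_bool (d \<le> K \<and> squarefull k) * mobius_mu d) * e (real (d * k) * \<alpha>))
      \<le> (\<Sum>k=1..N div d. of_bool (d \<le> K) * of_bool (squarefull k))"
      using abs_mobius_mu_le_1[of d]
      by (intro sum_norm_le) (auto simp: norm_mult simp flip: of_int_abs)
    also have "\<dots> \<le> (\<Sum>k=1..N. of_bool (d \<le> K) * of_bool (squarefull k))"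
      by (intro sum_mono2) (auto intro: order.trans[OF _ div_le_dividend])
    finally show "norm (\<Sum>k=1..N div d. of_int (of_bool (d \<le> K \<and> squarefull k) * mobius_mu d) * e (real (d * k) * \<alpha>))
      \<le> (\<Sum>k=1..N. of_bool (d \<le> K) * of_bool (squarefull k))" .
  qed
  also have "\<dots> = (\<Sum>d=1..N. of_bool (d \<le> K)) * (\<Sum>k=1..N. of_bool (squarefull k))"
    by (rule sum_product[symmetric])
  also have "(\<Sum>d=1..N. of_bool (d \<le> K)) = (\<Sum>d=1..min N K. 1::real)"
    by (intro sum.mono_neutral_cong_right) auto
  also have "(\<Sum>k=1..N. of_bool (squarefull k)) = (\<Sum>k\<in>{n\<in>{1..N}. squarefull n}. 1::real)"
    by (intro sum.mono_neutral_cong_right) auto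
  also have "(\<Sum>d=1..min N K. 1::real) * (\<Sum>k\<in>{n\<in>{1..N}. squarefull n}. 1::real)
      \<le> real K * (sqrt (real N) * (1 + ln (real N)))"
    using card_squarefull_le[OF N] by (intro mult_mono) auto
  finally show ?thesis .
qed

text \<open>Opening the truncated divisor sum as k = v j with v \<le> K leaves a free variable j,
  hence a geometric sum with frequency \<alpha> m v. Each w = m v \<le> \<open>K\<^sup>2\<close>
  arises from at most as many pairs as it has divisors.\<close>

lemma type_I_sum_le_kern:
  "norm (\<Sum>m=1..N. \<Sum>k=1..N div m. of_int (of_bool (m \<le> K) * mu_hat m * mobius_trunc K k) * e (real (m * k) * \<alpha>))
   \<le> (\<Sum>w=1..K\<^sup>2. real (card {d. d dvd w}) * kern (real N / real w) (\<alpha> * real w))"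
proof -
  define F where "F w = kern (real N / real w) (\<alpha> * real w)" for w :: nat
  have F_nonneg: "F w \<ge> 0" for w by (simp add: F_def kern_nonneg)
  have inner: "norm (\<Sum>k=1..N div m. of_int (mobius_trunc K k) * e (real (m * k) * \<alpha>)) \<le> (\<Sum>v=1..K. F (m * v))"
    if m: "m \<ge> 1" for m
  proof -
    have "(\<Sum>k=1..N div m. of_int (mobius_trunc K k) * e (real (m * k) * \<alpha>))
      = (\<Sum>k=1..N div m. \<Sum>v | v dvd k. of_bool (v \<le> K) * of_int (mobius_mu v) * e (real (k div v) * (\<alpha> * real (m * v))))"
    proof (intro sum.cong refl)
      fix k assume "k \<in> {1..N div m}"
      then have k: "k > 0" by simp
      have "(of_int (mobius_trunc K k) :: complex) = (\<Sum>v | v dvd k. of_bool (v \<le> K) * of_int (mobius_mu v))"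
        unfolding mobius_trunc_def of_int_sum using k by (intro sum.mono_neutral_cong_left) auto
      also have "\<dots> * e (real (m * k) * \<alpha>) = (\<Sum>v | v dvd k. of_bool (v \<le> K) * of_int (mobius_mu v) * e (real (k div v) * (\<alpha> * real (m * v))))"
        unfolding sum_distrib_right
      proof (intro sum.cong refl)
        fix v assume "v \<in> {v. v dvd k}"
        then have kv: "real k = real v * real (k div v)" by (simp flip: of_nat_mult)
        have "real (m * k) * \<alpha> = real (k div v) * (\<alpha> * real (m * v))" by (simp only: kv of_nat_mult mult_ac)
        then show "of_bool (v \<le> K) * of_int (mobius_mu v) * e (real (m * k) * \<alpha>)
          = of_bool (v \<le> K) * of_int (mobius_mu v) * e (real (k div v) * (\<alpha> * real (m * v)))" by (simp only:)
      qed
      finally show "of_int (mobius_trunc K k) * e (real (m * k) * \<alpha>) = (\<Sum>v | v dvd k. of_bool (v \<le> K) * of_int (mobius_mu v) * e (real (k div v) * (\<alpha> * real (m * v))))" .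
    qed
    also have "\<dots> = (\<Sum>v=1..N div m. \<Sum>j=1..N div m div v. of_bool (v \<le> K) * of_int (mobius_mu v) * e (real j * (\<alpha> * real (m * v))))"
      by (rule sum_sum_divisors)
    also have "norm \<dots> \<le> (\<Sum>v=1..N div m. of_bool (v \<le> K) * F (m * v))"
    proof (intro sum_norm_le)
      fix v assume v: "v \<in> {1..N div m}"
      have "norm (\<Sum>j=1..N div m div v. e (real j * (\<alpha> * real (m * v)))) \<le> F (m * v)"
        unfolding F_def
      proof (rule norm_sum_e_le_kern)
        have "N div m div v = N div (m * v)" by (rule div_mult2_eq[symmetric])
        then show "real (N div m div v) \<le> real N / real (m * v)"
          using real_div_bounds(1)[of "m * v" N] v m by simp
      qed
      then have "norm (of_bool (v \<le> K) * of_int (mobius_mu v) :: complex) * norm (\<Sum>j=1..N div m div v. e (real j * (\<alpha> * real (m * v)))) \<le> of_bool (v \<le> K) * F (m * v)"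
        using abs_mobius_mu_le_1[of v]
        by (intro mult_mono) (auto simp: norm_mult simp flip: of_int_abs)
      then show "norm (\<Sum>j=1..N div m div v. of_bool (v \<le> K) * of_int (mobius_mu v) * e (real j * (\<alpha> * real (m * v)))) \<le> of_bool (v \<le> K) * F (m * v)"
        by (simp only: sum_distrib_left[symmetric] norm_mult)
    qed
    also have "\<dots> = (\<Sum>v=1..min K (N div m). F (m * v))"
      by (intro sum.mono_neutral_cong_right) auto
    also have "\<dots> \<le> (\<Sum>v=1..K. F (m * v))" by (intro sum_mono2 F_nonneg) auto
    finally show ?thesis .
  qed
  have "norm (\<Sum>m=1..N. \<Sum>k=1..N div m. of_int (of_bool (m \<le> K) * mu_hat m * mobius_trunc K k) * e (real (m * k) * \<alpha>))
    \<le> (\<Sum>m=1..N. of_bool (m \<le> K) * (\<Sum>v=1..K. F (m * v)))"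
  proof (intro sum_norm_le)
    fix m assume m: "m \<in> {1..N}"
    have "(\<Sum>k=1..N div m. of_int (of_bool (m \<le> K) * mu_hat m * mobius_trunc K k) * e (real (m * k) * \<alpha>))
      = of_int (of_bool (m \<le> K) * mu_hat m) * (\<Sum>k=1..N div m. of_int (mobius_trunc K k) * e (real (m * k) * \<alpha>))"
      by (simp add: sum_distrib_left mult_ac)
    also have "norm \<dots> \<le> of_bool (m \<le> K) * (\<Sum>v=1..K. F (m * v))"
      unfolding norm_mult using inner[of m] m abs_mu_hat_le_1[of m]
      by (intro mult_mono) (auto simp: norm_mult simp flip: of_int_abs)
    finally show "norm (\<Sum>k=1..N div m. of_int (of_bool (m \<le> K) * mu_hat m * mobius_trunc K k) * e (real (m * k) * \<alpha>))
      \<le> of_bool (m \<le> K) * (\<Sum>v=1..K. F (m * v))" .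
  qed
  also have "\<dots> = (\<Sum>m=1..min K N. \<Sum>v=1..K. F (m * v))"
    by (intro sum.mono_neutral_cong_right) auto
  also have "\<dots> \<le> (\<Sum>m=1..K. \<Sum>v=1..K. F (m * v))"
    by (intro sum_mono2 sum_nonneg F_nonneg) auto
  \<comment> \<open>The square m, v \<le> K lies under the hyperbola m v \<le>
    \<open>K\<^sup>2\<close>; by positivity the sum may be enlarged to it and then grouped by w = m
    v.\<close>
  also have "\<dots> \<le> (\<Sum>m=1..K. \<Sum>v=1..K\<^sup>2 div m. F (m * v))"
  proof (intro sum_mono sum_mono2 F_nonneg)
    fix m assume m: "m \<in> {1..K}"
    then have "K \<le> K\<^sup>2 div m"
      by (auto simp: less_eq_div_iff_mult_less_eq power2_eq_square)
    then show "{1..K} \<subseteq> {1..K\<^sup>2 div m}" by auto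
  qed auto
  also have "\<dots> \<le> (\<Sum>m=1..K\<^sup>2. \<Sum>v=1..K\<^sup>2 div m. F (m * v))"
    by (intro sum_mono2 sum_nonneg F_nonneg) (auto simp: power2_eq_square intro: order.trans)
  also have "\<dots> = (\<Sum>w=1..K\<^sup>2. \<Sum>m | m dvd w. F (m * (w div m)))"
    by (rule sum_sum_divisors[symmetric])
  also have "\<dots> = (\<Sum>w=1..K\<^sup>2. real (card {d. d dvd w}) * F w)"
    by (intro sum.cong refl) simp
  finally show ?thesis by (simp add: F_def)
qed

text \<open>The kernel F is split as sqrt F times sqrt F, and one root is bounded by sqrt(N / w).
  The divisor weight is thus squared only against N / w, and the other factor is a kernel sum
  without weight.\<close>

lemma type_I_sum_squared_le:
  assumes ra: "rat_approx \<alpha> a q" and q: "q \<le> N" and K: "1 \<le> K" "K\<^sup>2 \<le> N"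
  shows "(norm (\<Sum>m=1..N. \<Sum>k=1..N div m. of_int (of_bool (m \<le> K) * mu_hat m * mobius_trunc K k) * e (real (m * k) * \<alpha>)))\<^sup>2
   \<le> 16 * (1 + ln (real N)) ^ 5 * real N * (real N / real q + real (K\<^sup>2) + real q)"
proof -
  define l where "l = 1 + ln (real N)"
  define \<tau> where "\<tau> w = real (card {d. d dvd w})" for w :: nat
  define F where "F w = kern (real N / real w) (\<alpha> * real w)" for w :: nat
  have N: "N \<ge> 1" using order.trans[OF one_le_power[OF K(1)] K(2)] .
  then have l: "l \<ge> 1" by (simp add: l_def)
  have F: "0 \<le> F w" "F w \<le> real N / real w" for w by (simp_all add: F_def kern_nonneg kern_le)
  have "norm (\<Sum>m=1..N. \<Sum>k=1..N div m. of_int (of_bool (m \<le> K) * mu_hat m * mobius_trunc K k) * e (real (m * k) * \<alpha>))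
    \<le> (\<Sum>w=1..K\<^sup>2. \<tau> w * F w)" (is "norm ?S \<le> _")
    unfolding \<tau>_def F_def by (rule type_I_sum_le_kern)
  also have "\<dots> \<le> (\<Sum>w=1..K\<^sup>2. (\<tau> w * sqrt (real N / real w)) * sqrt (F w))"
  proof (intro sum_mono)
    fix w
    have "F w = sqrt (F w) * sqrt (F w)" using F by simp
    also have "\<dots> \<le> sqrt (real N / real w) * sqrt (F w)"
      using F by (intro mult_right_mono real_sqrt_le_mono) auto
    finally show "\<tau> w * F w \<le> (\<tau> w * sqrt (real N / real w)) * sqrt (F w)"
      unfolding mult.assoc by (intro mult_left_mono) (auto simp: \<tau>_def)
  qed
  finally have "(norm ?S)\<^sup>2 \<le> (\<Sum>w=1..K\<^sup>2. (\<tau> w * sqrt (real N / real w)) * sqrt (F w))\<^sup>2"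
    by (intro power_mono) auto
  also have "\<dots> \<le> (\<Sum>w=1..K\<^sup>2. (\<tau> w * sqrt (real N / real w))\<^sup>2) * (\<Sum>w=1..K\<^sup>2. (sqrt (F w))\<^sup>2)"
    by (rule Cauchy_Schwarz_ineq_sum)
  also have "(\<Sum>w=1..K\<^sup>2. (sqrt (F w))\<^sup>2) = (\<Sum>w=1..K\<^sup>2. F w)" using F by simp
  also have "(\<Sum>w=1..K\<^sup>2. (\<tau> w * sqrt (real N / real w))\<^sup>2) = real N * (\<Sum>w=1..K\<^sup>2. (\<tau> w)\<^sup>2 / real w)"
    by (simp add: power_mult_distrib sum_distrib_left mult_ac)
  also have "real N * (\<Sum>w=1..K\<^sup>2. (\<tau> w)\<^sup>2 / real w) * (\<Sum>w=1..K\<^sup>2. F w)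
     \<le> real N * l ^ 4 * (16 * l * (real N / real q + real (K\<^sup>2) + real q))"
  proof (intro mult_mono mult_left_mono)
    have "(\<Sum>w=1..K\<^sup>2. (\<tau> w)\<^sup>2 / real w) \<le> (\<Sum>k=1..K\<^sup>2. 1 / real k) ^ 4"
      unfolding \<tau>_def by (rule sum_card_divisors_squared_over_le)
    also have "\<dots> \<le> l ^ 4"
    proof (intro power_mono sum_nonneg)
      have "(\<Sum>k=1..K\<^sup>2. 1 / real k) \<le> 1 + ln (real (K\<^sup>2))" using K by (intro sum_inverse_le_ln) auto
      also have "ln (real (K\<^sup>2)) \<le> ln (real N)" using K N by (subst ln_le_cancel_iff) (auto simp del: of_nat_power)
      finally show "(\<Sum>k=1..K\<^sup>2. 1 / real k) \<le> l" by (simp add: l_def)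
    qed auto
    finally show "(\<Sum>w=1..K\<^sup>2. (\<tau> w)\<^sup>2 / real w) \<le> l ^ 4" .
    show "(\<Sum>w=1..K\<^sup>2. F w) \<le> 16 * l * (real N / real q + real (K\<^sup>2) + real q)"
      unfolding F_def l_def by (rule sum_kern_hyperbola_le[OF ra q K(2)])
  qed (use F l in \<open>auto intro: sum_nonneg\<close>)
  also have "\<dots> = 16 * l ^ 5 * real N * (real N / real q + real (K\<^sup>2) + real q)"
    by (simp add: power_numeral_reduce mult_ac)
  finally show ?thesis unfolding l_def .
qed

text \<open>Q dominates both the length M of the block and the dual length N / M. Of the three
  logarithms two come from the mean square and one from the kernel; 48 is 3 from the mean square
  times 16 from the expanded product.\<close>

lemma type_II_dyadic_block_le:
  assumes ra: "rat_approx \<alpha> a q" and q: "q \<le> N" and M: "M \<ge> 1" "M \<le> N"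
    and Q: "real M \<le> Q" "real N / real M \<le> Q"
  shows "(norm (\<Sum>m\<in>{M..<2*M}. \<Sum>k=1..N div m.
      of_real (real_of_int (mu_hat m) * (of_bool (k > K) * real_of_int (mobius_trunc K k))) * e (real (m * k) * \<alpha>)))\<^sup>2
    \<le> 48 * (1 + ln (real N)) ^ 3 * real N * (real N / real q + 2 * Q + real q)"
proof -
  define l where "l = 1 + ln (real N)"
  define b where "b k = of_bool (k > K) * real_of_int (mobius_trunc K k)" for k
  have q1: "q \<ge> 1" using ra by (simp add: rat_approx_def)
  have N: "N \<ge> 1" using M by simp
  then have l: "l \<ge> 1" by (simp add: l_def)
  have lq: "1 + ln (2 * real q) \<le> 2 * l" unfolding l_def by (rule ln_double_le[OF q1 q])
  have Y: "N div M \<ge> 1" using M by (simp add: less_eq_div_iff_mult_less_eq)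
  have "(norm (\<Sum>m\<in>{M..<2*M}. \<Sum>k=1..N div m. of_real (real_of_int (mu_hat m) * b k) * e (real (m * k) * \<alpha>)))\<^sup>2
    \<le> (\<Sum>n=1..N div M. (b n)\<^sup>2) *
       (real M * ((2 * real M / real q + 1) * (2 * (real N / real M) + 4 * real q * (1 + ln (2 * real q)))))"
    using abs_mu_hat_le_1 M by (intro bilinear_sum_squared_le[OF ra]) (auto simp flip: of_int_abs)
  also have "\<dots> \<le> (3 * (real N / real M) * l\<^sup>2) * (real M * ((2 * real M / real q + 1) * (2 * (real N / real M) + 4 * real q * (2 * l))))"
  proof (intro mult_mono mult_left_mono add_left_mono lq)
    have "(\<Sum>n=1..N div M. (b n)\<^sup>2) \<le> (\<Sum>n=1..N div M. (real_of_int (mobius_trunc K n))\<^sup>2)"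
      by (intro sum_mono) (auto simp: b_def)
    also have "\<dots> \<le> 3 * real (N div M) * (1 + ln (real (N div M)))\<^sup>2"
      by (rule sum_mobius_trunc_squared_le[OF Y])
    also have "\<dots> \<le> 3 * (real N / real M) * l\<^sup>2"
    proof (intro mult_mono power_mono mult_left_mono)
      show "real (N div M) \<le> real N / real M" using M by (intro real_div_bounds) auto
      have "real (N div M) \<le> real N" by simp
      then have "ln (real (N div M)) \<le> ln (real N)" using Y N by (subst ln_le_cancel_iff) auto
      then show "1 + ln (real (N div M)) \<le> l" by (simp add: l_def)
    qed (use Y in auto)
    finally show "(\<Sum>n=1..N div M. (b n)\<^sup>2) \<le> 3 * (real N / real M) * l\<^sup>2" .
  qed (use l q1 in auto)
  also have "\<dots> = 3 * l\<^sup>2 * real N * (4 * 1 * (real N / real q) + 16 * l * real M + 2 * 1 * (real N / real M) + 8 * l * real q)"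
    using M q1 by (simp add: field_simps)
  also have "\<dots> \<le> 3 * l\<^sup>2 * real N * (16 * l * (real N / real q) + 16 * l * Q + 16 * l * Q + 16 * l * real q)"
    using l Q by (intro mult_left_mono add_mono mult_mono) auto
  also have "\<dots> = 48 * l ^ 3 * real N * (real N / real q + 2 * Q + real q)"
    by (simp add: algebra_simps power2_eq_square power3_eq_cube)
  finally show ?thesis unfolding l_def b_def .
qed

lemma sum_dyadic_blocks:
  fixes g :: "nat \<Rightarrow> 'a::comm_monoid_add"
  shows "(\<Sum>m\<in>{M..<M * 2 ^ J}. g m) = (\<Sum>j<J. \<Sum>m\<in>{M * 2 ^ j..<2 * (M * 2 ^ j)}. g m)"
proof (induction J)
  case (Suc J)
  have "(\<Sum>m\<in>{M..<M * 2 ^ Suc J}. g m)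
      = (\<Sum>m\<in>{M..<M * 2 ^ J}. g m) + (\<Sum>m\<in>{M * 2 ^ J..<M * 2 ^ Suc J}. g m)"
    by (rule sum.atLeastLessThan_concat[symmetric]) auto
  then show ?case by (simp add: Suc.IH mult_ac)
qed simp

lemma exists_power_of_two_gt:
  assumes N: "N \<ge> 1"
  obtains J where "N < 2 ^ J" "real J \<le> 2 * (1 + ln (real N))"
proof -
  obtain n where n: "2 ^ n \<le> N" "N < 2 ^ (n + 1)"
    using ex_power_ivl1[of 2 N] N by auto
  have "(2::real) ^ n \<le> real N" using n(1) by (metis numeral_power_le_of_nat_cancel_iff)
  then have "ln ((2::real) ^ n) \<le> ln (real N)" using N by (subst ln_le_cancel_iff) auto
  then have "real n * ln 2 \<le> ln (real N)" by (simp add: ln_realpow)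
  moreover have "ln 2 \<ge> (1 / 2 :: real)" using ln2_ge_two_thirds by linarith
  then have "real n * ln 2 \<ge> real n * (1 / 2)" by (intro mult_left_mono) auto
  ultimately have "real (n + 1) \<le> 2 * (1 + ln (real N))" by simp
  with n(2) show thesis by (rule that[of "n + 1"])
qed

text \<open>As both variables exceed K, a block starting at M is nonzero only if M (K + 1) \<le> N.
  Hence M and N / M are both at most N / (K + 1), and one bound serves all blocks.\<close>

lemma type_II_sum_le:
  assumes ra: "rat_approx \<alpha> a q" and q: "q \<le> N" and N: "N \<ge> 1" and Q: "real N / real (K + 1) \<le> Q"
  shows "norm (\<Sum>m=1..N. \<Sum>k=1..N div m. of_int (of_bool (m > K \<and> k > K) * mu_hat m * mobius_trunc K k) * e (real (m * k) * \<alpha>))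
    \<le> 2 * (1 + ln (real N)) * sqrt (48 * (1 + ln (real N)) ^ 3 * real N * (real N / real q + 2 * Q + real q))"
proof -
  define G where "G m = (\<Sum>k=1..N div m. of_real (real_of_int (mu_hat m) * (of_bool (k > K) * real_of_int (mobius_trunc K k))) * e (real (m * k) * \<alpha>))" for m
  define W where "W = sqrt (48 * (1 + ln (real N)) ^ 3 * real N * (real N / real q + 2 * Q + real q))"
  have Q0: "Q \<ge> 0" using Q by (rule order.trans[rotated]) auto
  have W0: "W \<ge> 0" unfolding W_def using Q0 N by (intro real_sqrt_ge_zero mult_nonneg_nonneg) auto
  \<comment> \<open>The blocks start at K + 1 and run past N; an m > N contributes nothing because
    \<open>N div m\<close> is 0.\<close>
  obtain J where J: "N < 2 ^ J" "real J \<le> 2 * (1 + ln (real N))"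
    using exists_power_of_two_gt[OF N] .
  have "(\<Sum>m=1..N. \<Sum>k=1..N div m. of_int (of_bool (m > K \<and> k > K) * mu_hat m * mobius_trunc K k) * e (real (m * k) * \<alpha>))
    = (\<Sum>m=1..N. of_bool (m > K) * G m)"
    unfolding G_def sum_distrib_left by (intro sum.cong refl) auto
  also have "\<dots> = (\<Sum>m\<in>{K+1..<(K+1) * 2 ^ J}. G m)"
  proof (rule sum.mono_neutral_cong)
    have "N < (K + 1) * 2 ^ J" using J(1) by (simp add: trans_less_add1)
    then show "of_bool (m > K) * G m = 0" if "m \<in> {1..N} - {K+1..<(K+1) * 2 ^ J}" for m
      using that by auto
    show "G m = 0" if "m \<in> {K+1..<(K+1) * 2 ^ J} - {1..N}" for m
    proof -
      have "N < m" using that by auto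
      then show ?thesis by (simp add: G_def)
    qed
  qed auto
  also have "\<dots> = (\<Sum>j<J. \<Sum>m\<in>{(K+1) * 2 ^ j..<2 * ((K+1) * 2 ^ j)}. G m)"
    by (rule sum_dyadic_blocks)
  also have "norm \<dots> \<le> (\<Sum>j<J. W)"
  proof (intro sum_norm_le)
    fix j
    define M where "M = (K + 1) * 2 ^ j"
    have M: "M \<ge> K + 1" using mult_le_mono2[of 1 "2 ^ j" "K + 1"] by (simp add: M_def)
    show "norm (\<Sum>m\<in>{(K+1) * 2 ^ j..<2 * ((K+1) * 2 ^ j)}. G m) \<le> W"
      unfolding M_def[symmetric]
    proof (cases "M * (K + 1) \<le> N")
      case True
      have "real M * real (K + 1) \<le> real N" using True by (simp only: of_nat_mult[symmetric] of_nat_le_iff)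
      then have "real M \<le> real N / real (K + 1)" by (simp add: field_simps)
      then have MQ: "real M \<le> Q" using Q by linarith
      have "real N / real M \<le> real N / real (K + 1)"
        using M by (intro divide_left_mono) auto
      then have NQ: "real N / real M \<le> Q" using Q by linarith
      have "M \<le> N" using True by simp
      then have "(norm (\<Sum>m\<in>{M..<2 * M}. G m))\<^sup>2 \<le> 48 * (1 + ln (real N)) ^ 3 * real N * (real N / real q + 2 * Q + real q)"
        unfolding G_def using M by (intro type_II_dyadic_block_le[OF ra q _ _ MQ NQ]) auto
      then show "norm (\<Sum>m\<in>{M..<2 * M}. G m) \<le> W" unfolding W_def by (rule real_le_rsqrt)
    next
      case False
      have "G m = 0" if m: "m \<in> {M..<2 * M}" for m
        unfolding G_def
      proof (rule sum.neutral, safe)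
        fix k assume k: "k \<in> {1..N div m}"
        have "m > 0" using m M by auto
        then have "m * k \<le> N" using k by (auto simp: less_eq_div_iff_mult_less_eq mult.commute)
        moreover have "M * k \<le> m * k" using m by auto
        ultimately have "M * k < M * (K + 1)" using False by linarith
        then have "k < K + 1" unfolding mult_less_cancel1 by simp
        then have "\<not> k > K" by simp
        then show "of_real (real_of_int (mu_hat m) * (of_bool (k > K) * real_of_int (mobius_trunc K k))) * e (real (m * k) * \<alpha>) = 0" by simp
      qed
      then show "norm (\<Sum>m\<in>{M..<2 * M}. G m) \<le> W" using W0 by simp
    qed
  qed
  also have "\<dots> = real J * W" by simp
  also have "\<dots> \<le> 2 * (1 + ln (real N)) * W" by (intro mult_right_mono J W0)
  finally show ?thesis unfolding W_def .
qed

section \<open>Summation of Vaughan's identity and choice of the cut-off\<close>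

lemma sum_mu_hat_decomposition:
  assumes K: "1 \<le> K" "K \<le> N"
  shows "(\<Sum>n=1..N. of_int (mu_hat n) * e (real n * \<alpha>)) =
    (\<Sum>n=1..K. of_int (mu_hat n) * e (real n * \<alpha>))
    + (\<Sum>d=1..N. \<Sum>k=1..N div d. of_int (of_bool (d \<le> K \<and> squarefull k) * mobius_mu d) * e (real (d * k) * \<alpha>))
    - (\<Sum>m=1..N. \<Sum>k=1..N div m. of_int (of_bool (m \<le> K) * mu_hat m * mobius_trunc K k) * e (real (m * k) * \<alpha>))
    - (\<Sum>m=1..N. \<Sum>k=1..N div m. of_int (of_bool (m > K \<and> k > K) * mu_hat m * mobius_trunc K k) * e (real (m * k) * \<alpha>))"
proof -
  have conv: "(\<Sum>n=1..N. of_int (\<Sum>d | d dvd n. g d (n div d)) * e (real n * \<alpha>))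
      = (\<Sum>d=1..N. \<Sum>k=1..N div d. of_int (g d k) * e (real (d * k) * \<alpha>))" for g :: "nat \<Rightarrow> nat \<Rightarrow> int"
  proof -
    have "(\<Sum>n=1..N. of_int (\<Sum>d | d dvd n. g d (n div d)) * e (real n * \<alpha>))
      = (\<Sum>n=1..N. \<Sum>d | d dvd n. of_int (g d (n div d)) * e (real (d * (n div d)) * \<alpha>))"
      by (intro sum.cong refl) (simp add: sum_distrib_right del: of_nat_mult)
    also have "\<dots> = (\<Sum>d=1..N. \<Sum>k=1..N div d. of_int (g d k) * e (real (d * k) * \<alpha>))"
      by (rule sum_sum_divisors)
    finally show ?thesis .
  qed
  have "(\<Sum>n=1..N. of_int (mu_hat n) * e (real n * \<alpha>)) =
    (\<Sum>n=1..N. of_int (of_bool (n \<le> K) * mu_hat n) * e (real n * \<alpha>)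
    + of_int (\<Sum>d | d dvd n. of_bool (d \<le> K \<and> squarefull (n div d)) * mobius_mu d) * e (real n * \<alpha>)
    - of_int (\<Sum>m | m dvd n. of_bool (m \<le> K) * mu_hat m * mobius_trunc K (n div m)) * e (real n * \<alpha>)
    - of_int (\<Sum>m | m dvd n. of_bool (m > K \<and> n div m > K) * mu_hat m * mobius_trunc K (n div m)) * e (real n * \<alpha>))"
    unfolding left_diff_distrib[symmetric] distrib_right[symmetric] of_int_add[symmetric] of_int_diff[symmetric]
    using K by (intro sum.cong refl, subst vaughan_identity_mu_hat[of _ K]) auto
  also have "\<dots> = (\<Sum>n=1..N. of_int (of_bool (n \<le> K) * mu_hat n) * e (real n * \<alpha>))
    + (\<Sum>n=1..N. of_int (\<Sum>d | d dvd n. of_bool (d \<le> K \<and> squarefull (n div d)) * mobius_mu d) * e (real n * \<alpha>))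
    - (\<Sum>n=1..N. of_int (\<Sum>m | m dvd n. of_bool (m \<le> K) * mu_hat m * mobius_trunc K (n div m)) * e (real n * \<alpha>))
    - (\<Sum>n=1..N. of_int (\<Sum>m | m dvd n. of_bool (m > K \<and> n div m > K) * mu_hat m * mobius_trunc K (n div m)) * e (real n * \<alpha>))"
    by (simp only: sum.distrib sum_subtractf)
  also have "(\<Sum>n=1..N. of_int (of_bool (n \<le> K) * mu_hat n) * e (real n * \<alpha>)) = (\<Sum>n=1..K. of_int (mu_hat n) * e (real n * \<alpha>))"
    using K by (intro sum.mono_neutral_cong_right) auto
  finally show ?thesis
    by (simp only: conv[of "\<lambda>d k. of_bool (d \<le> K \<and> squarefull k) * mobius_mu d"]
      conv[of "\<lambda>m k. of_bool (m \<le> K) * mu_hat m * mobius_trunc K k"]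
      conv[of "\<lambda>m k. of_bool (m > K \<and> k > K) * mu_hat m * mobius_trunc K k"])
qed

lemma norm_sum_mu_hat_le:
  "norm (\<Sum>n=1..N. of_int (mu_hat n) * e (real n * \<alpha>)) \<le> real N"
proof -
  have "norm (\<Sum>n=1..N. of_int (mu_hat n) * e (real n * \<alpha>)) \<le> (\<Sum>n=1..N. 1)"
  proof (intro sum_norm_le)
    fix n assume "n \<in> {1..N}"
    then show "norm (of_int (mu_hat n) * e (real n * \<alpha>)) \<le> 1"
      using abs_mu_hat_le_1[of n] by (simp add: norm_mult flip: of_int_abs)
  qed
  then show ?thesis by simp
qed

text \<open>With 1 + log N in place of log N the logarithmic factor is at least 1, so that lower
  powers can be absorbed. The constant 26 is 1 + 1 + 4 + 20 from the four sums.\<close>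

lemma sum_mu_hat_e_le:
  fixes N :: nat
  assumes ra: "rat_approx \<alpha> a q" and N: "N \<ge> 1"
  shows "norm (\<Sum>n=1..N. of_int (mu_hat n) * e (real n * \<alpha>))
    \<le> 26 * ((real N powr (5/6) + real q powr (1/2) * real N powr (1/2) + real N / real q powr (1/2))
             * (1 + ln (real N)) powr (5/2))"
proof -
  define l where "l = 1 + ln (real N)"
  define A where "A = real N powr (5/6)"
  define B where "B = real q powr (1/2) * real N powr (1/2)"
  define D where "D = real N / real q powr (1/2)"
  have q1: "q \<ge> 1" using ra by (simp add: rat_approx_def)
  have l: "l \<ge> 1" using N by (simp add: l_def)
  have l52: "l powr (5/2) \<ge> 1" "l powr (5/2) \<ge> l"
    using l powr_mono[of 0 "5/2" l] powr_mono[of 1 "5/2" l] by auto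
  have nonneg: "A \<ge> 0" "B \<ge> 0" "D \<ge> 0" by (simp_all add: A_def B_def D_def)
  define W where "W = A + B + D"
  have W: "W \<ge> 0" "A \<le> W" "B \<le> W" using nonneg by (simp_all add: W_def)
  \<comment> \<open>The type I and type II bounds are for squares, or are square roots, so the three
    terms of the estimate appear there as their squares.\<close>
  have sq: "A\<^sup>2 + B\<^sup>2 + D\<^sup>2 \<le> W\<^sup>2"
    using nonneg by (simp add: W_def power2_eq_square algebra_simps)
  have B2: "B\<^sup>2 = real N * real q" and D2: "D\<^sup>2 = real N * (real N / real q)"
    by (simp_all add: B_def D_def power_mult_distrib power_divide powr_half_sqrt power2_eq_square[of "real N"])
  have "norm (\<Sum>n=1..N. of_int (mu_hat n) * e (real n * \<alpha>)) \<le> 26 * (W * l powr (5/2))"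
  proof (cases "q \<le> N")
    \<comment> \<open>For q > N the term B = sqrt(q N) exceeds N, and the trivial bound is
      enough.\<close>
    case False
    have "(real N)\<^sup>2 \<le> B\<^sup>2" unfolding B2 power2_eq_square[of "real N"] using False by (intro mult_left_mono) auto
    then have "real N \<le> B" using nonneg(2) by (rule power2_le_imp_le)
    also have "\<dots> \<le> W * 1" using W by simp
    also have "\<dots> \<le> W * l powr (5/2)" using W l52 by (intro mult_left_mono) auto
    also have "\<dots> \<le> 26 * (W * l powr (5/2))" using W l52 by simp
    finally show ?thesis using norm_sum_mu_hat_le by (rule order.trans[rotated])
  next
    case q: True
    \<comment> \<open>The cut-off \<open>N\<^sup>1\<^sup>/\<^sup>3\<close> balances type I (\<open>c\<^sup>2\<close>) and type II (\<open>N / c\<close>).\<close>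
    define c where "c = real N powr (1/3)"
    define K where "K = nat \<lfloor>c\<rfloor>"
    have c1: "c \<ge> 1" using N by (simp add: c_def ge_one_powr_ge_zero)
    have K: "real K \<le> c" "c \<le> real (K + 1)" "K \<ge> 1"
      using c1 unfolding K_def by (auto simp: le_nat_floor) linarith
    have c3: "c * c\<^sup>2 = real N"
      unfolding c_def power2_eq_square using N by (simp flip: powr_add)
    \<comment> \<open>This is 1/3 + 1/2 = 5/6. Squared, it identifies the contribution N c^2 of type
      I and type II with the square of A.\<close>
    have cN: "c * sqrt (real N) = A"
      unfolding c_def A_def by (simp add: powr_half_sqrt[symmetric] powr_add[symmetric])
    have A2: "A\<^sup>2 = real N * c\<^sup>2"
      unfolding cN[symmetric] by (simp add: power_mult_distrib)
    have c2N: "c\<^sup>2 \<le> real N" using c3 c1 mult_right_mono[of 1 c "c\<^sup>2"] by simp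
    have K2c: "real (K\<^sup>2) \<le> c\<^sup>2" using K by (simp add: power_mono)
    then have K2: "K\<^sup>2 \<le> N" using c2N by linarith
    have KN: "K \<le> N" using K2 K(3) by (metis le_trans power2_nat_le_imp_le order_refl)
    have S1: "norm (\<Sum>n=1..K. of_int (mu_hat n) * e (real n * \<alpha>)) \<le> W * l powr (5/2)"
    proof -
      have "norm (\<Sum>n=1..K. of_int (mu_hat n) * e (real n * \<alpha>)) \<le> real K" by (rule norm_sum_mu_hat_le)
      also have "\<dots> \<le> c * 1" using K by simp
      also have "\<dots> \<le> c * sqrt (real N)" using c1 N by (intro mult_left_mono) auto
      also have "\<dots> \<le> W * 1" using cN W by simp
      also have "\<dots> \<le> W * l powr (5/2)" using W l52 by (intro mult_left_mono) auto
      finally show ?thesis .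
    qed
    have S2: "norm (\<Sum>d=1..N. \<Sum>k=1..N div d. of_int (of_bool (d \<le> K \<and> squarefull k) * mobius_mu d) * e (real (d * k) * \<alpha>))
      \<le> W * l powr (5/2)" (is "norm ?S2 \<le> _")
    proof -
      have "norm ?S2 \<le> real K * (sqrt (real N) * l)" unfolding l_def by (rule squarefull_sum_le[OF N])
      also have "\<dots> \<le> c * (sqrt (real N) * l)" using K l by (intro mult_right_mono) auto
      also have "\<dots> = A * l" using cN by simp
      also have "\<dots> \<le> W * l powr (5/2)" using W l l52 nonneg by (intro mult_mono) auto
      finally show ?thesis .
    qed
    have S3: "norm (\<Sum>m=1..N. \<Sum>k=1..N div m. of_int (of_bool (m \<le> K) * mu_hat m * mobius_trunc K k) * e (real (m * k) * \<alpha>))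
      \<le> 4 * (W * l powr (5/2))" (is "norm ?S3 \<le> _")
    proof -
      have "(norm ?S3)\<^sup>2 \<le> 16 * l ^ 5 * real N * (real N / real q + real (K\<^sup>2) + real q)"
        unfolding l_def by (rule type_I_sum_squared_le[OF ra q K(3) K2])
      also have "\<dots> \<le> 16 * l ^ 5 * real N * (real N / real q + c\<^sup>2 + real q)"
        using K2c l by (intro mult_left_mono) auto
      also have "\<dots> = 16 * l ^ 5 * (A\<^sup>2 + B\<^sup>2 + D\<^sup>2)"
        by (simp only: A2 B2 D2) (simp only: algebra_simps)
      also have "\<dots> \<le> 16 * l ^ 5 * W\<^sup>2" using sq l by (intro mult_left_mono) auto
      also have "l ^ 5 = (l powr (5/2))\<^sup>2"
        using l by (subst powr_power) simp_all
      also have "16 * (l powr (5/2))\<^sup>2 * W\<^sup>2 = (4 * (W * l powr (5/2)))\<^sup>2" by (simp add: power_mult_distrib)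
      finally show ?thesis by (rule power2_le_imp_le) (use W in simp)
    qed
    have S4: "norm (\<Sum>m=1..N. \<Sum>k=1..N div m. of_int (of_bool (m > K \<and> k > K) * mu_hat m * mobius_trunc K k) * e (real (m * k) * \<alpha>))
      \<le> 20 * (W * l powr (5/2))" (is "norm ?S4 \<le> _")
    proof -
      have "real N / real (K + 1) \<le> real N / c" using K c1 by (intro divide_left_mono) auto
      also have "\<dots> = c\<^sup>2" using c3 c1 by (simp add: field_simps)
      finally have "norm ?S4 \<le> 2 * l * sqrt (48 * l ^ 3 * real N * (real N / real q + 2 * c\<^sup>2 + real q))"
        unfolding l_def by (rule type_II_sum_le[OF ra q N])
      also have "\<dots> \<le> 2 * l * (10 * (W * l powr (3/2)))"
      proof (intro mult_left_mono real_le_lsqrt)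
        have "48 * l ^ 3 * real N * (real N / real q + 2 * c\<^sup>2 + real q)
           = 48 * l ^ 3 * (2 * A\<^sup>2 + B\<^sup>2 + D\<^sup>2)"
          by (simp only: A2 B2 D2) (simp only: algebra_simps)
        also have "\<dots> \<le> 48 * l ^ 3 * (2 * W\<^sup>2)"
        proof (rule mult_left_mono)
          have "B\<^sup>2 \<ge> 0" "D\<^sup>2 \<ge> 0" by simp_all
          then show "2 * A\<^sup>2 + B\<^sup>2 + D\<^sup>2 \<le> 2 * W\<^sup>2" using sq by linarith
        qed (use l in simp)
        \<comment> \<open>96 is rounded up to the perfect square 100.\<close>
        also have "\<dots> \<le> 100 * l ^ 3 * W\<^sup>2" using l by simp
        also have "\<dots> = (10 * (W * l powr (3/2)))\<^sup>2"
        proof -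
          have "l ^ 3 = (l powr (3/2))\<^sup>2" using l by (subst powr_power) simp_all
          then show ?thesis by (simp add: power_mult_distrib)
        qed
        finally show "48 * l ^ 3 * real N * (real N / real q + 2 * c\<^sup>2 + real q) \<le> (10 * (W * l powr (3/2)))\<^sup>2" .
      qed (use l W in auto)
      also have "\<dots> = 20 * (W * (l powr 1 * l powr (3/2)))" using l by simp
      also have "l powr 1 * l powr (3/2) = l powr (5/2)" by (subst powr_add[symmetric]) simp
      finally show ?thesis .
    qed
    have tri: "norm (x1 + x2 - x3 - x4) \<le> norm x1 + norm x2 + norm x3 + norm x4" for x1 x2 x3 x4 :: complex
      using norm_triangle_ineq4[of "x1 + x2 - x3" x4] norm_triangle_ineq4[of "x1 + x2" x3]
        norm_triangle_ineq[of x1 x2] by linarith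
    show ?thesis
      unfolding sum_mu_hat_decomposition[OF K(3) KN]
      using S1 S2 S3 S4 by (intro order.trans[OF tri]) linarith
  qed
  then show ?thesis by (simp add: W_def A_def B_def D_def l_def)
qed

theorem theorem1p6:
  shows "\<exists>C::real. \<forall>(\<alpha>::real) (a::int) (q::nat) (X::real).
    q \<ge> 1 \<longrightarrow> coprime a (int q) \<longrightarrow> \<bar>\<alpha> - of_int a / of_nat q\<bar> \<le> 1 / (of_nat q)^2 \<longrightarrow> X \<ge> 2 \<longrightarrow>
      norm (\<Sum>n | n \<ge> 1 \<and> real n \<le> X. of_int (mu_hat n) * e (of_nat n * \<alpha>))
        \<le> C * ((X powr (5/6) + real q powr (1/2) * X powr (1/2) + X / real q powr (1/2))
               * ln X powr (5/2))"
proof (intro exI[of _ "26 * 3 powr (5/2)"] allI impI)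
  fix \<alpha> :: real and a :: int and q :: nat and X :: real
  assume q: "q \<ge> 1" and "coprime a (int q)" "\<bar>\<alpha> - of_int a / of_nat q\<bar> \<le> 1 / (of_nat q)^2" and X: "X \<ge> 2"
  then have ra: "rat_approx \<alpha> a q" by (simp add: rat_approx_def)
  define N where "N = nat \<lfloor>X\<rfloor>"
  have N: "N \<ge> 2" "real N \<le> X" using X by (auto simp: N_def le_nat_floor)
  have "{n. n \<ge> 1 \<and> real n \<le> X} = {1..N}" using X by (auto simp: N_def le_nat_floor le_nat_iff le_floor_iff)
  then have "norm (\<Sum>n | n \<ge> 1 \<and> real n \<le> X. of_int (mu_hat n) * e (of_nat n * \<alpha>))
      = norm (\<Sum>n=1..N. of_int (mu_hat n) * e (real n * \<alpha>))" by simp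
  also have "\<dots> \<le> 26 * ((real N powr (5/6) + real q powr (1/2) * real N powr (1/2) + real N / real q powr (1/2))
             * (1 + ln (real N)) powr (5/2))"
    using N by (intro sum_mu_hat_e_le[OF ra]) auto
  also have "\<dots> \<le> 26 * ((X powr (5/6) + real q powr (1/2) * X powr (1/2) + X / real q powr (1/2))
             * (3 * ln X) powr (5/2))"
  proof (intro mult_left_mono mult_mono add_mono powr_mono2 divide_right_mono)
    \<comment> \<open>X \<ge> 2 gives log X \<ge> log 2 \<ge> 1/2, so 1 \<le> 2 log X; this is the
      source of the factor \<open>3 powr (5/2)\<close> in the constant.\<close>
    have "ln (real N) \<le> ln X" using N by (subst ln_le_cancel_iff) auto
    moreover have "ln X \<ge> ln 2" using X by (subst ln_le_cancel_iff) auto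
    moreover have "ln 2 \<ge> (1 / 2 :: real)" using ln2_ge_two_thirds by linarith
    ultimately show "1 + ln (real N) \<le> 3 * ln X" by linarith
  qed (use N X in auto)
  also have "(3 * ln X) powr (5/2) = 3 powr (5/2) * ln X powr (5/2)"
    using X by (intro powr_mult)
  finally show "norm (\<Sum>n | n \<ge> 1 \<and> real n \<le> X. of_int (mu_hat n) * e (of_nat n * \<alpha>))
        \<le> 26 * 3 powr (5/2) * ((X powr (5/6) + real q powr (1/2) * X powr (1/2) + X / real q powr (1/2))
               * ln X powr (5/2))" by (simp add: mult_ac)
qed

end
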